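(* Let $K$ be a field of characteristic $0$ and let $n\geq 2$. Every locally nilpotent derivation of $U_n$ that induces the zero derivation on $L_n\cong U_n/I_n$ (that is, every locally nilpotent derivation $D$ of $U_n$ with $D(U_n)\subseteq I_n$) is itself the zero derivation.
   Context: $U_n$ is the associative unital $K$-algebra generated by $l_1,\ldots,l_n,r_1,\ldots,r_n$ with defining relations $l_il_j=l_jl_i$ and $r_il_j=l_jr_i+r_ir_j$ for all $1\leq i,j\leq n$ (the universal multiplicative enveloping algebra, in the variety of left-symmetric algebras, of the $n$-dimensional algebra with zero multiplication). $L_n$ is the subalgebra generated by $l_1,\ldots,l_n$; it is the polynomial algebra $K[l_1,\ldots,l_n]$. $I_n$ is the two-sided ideal of $U_n$ generated by $r_1,\ldots,r_n$; $U_n=L_n\oplus I_n$ as vector spaces, so $U_n/I_n\cong L_n$. Every derivation $D$ of $U_n$ satisfies $D(I_n)\subseteq I_n$ and hence induces a derivation of $U_n/I_n\cong L_n$. A derivation is a $K$-linear map $D:U_n\to U_n$ with $D(xy)=D(x)y+xD(y)$; it is locally nilpotent if for every $a\in U_n$ there is a natural number $m$ with $D^m(a)=0$. *)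

theory Defs
  imports Complex_Main "HOL-Library.Poly_Mapping" "HOL-Library.Cardinality"
begin

section \<open>Two-sided ideals\<close>

text \<open>In a unital algebra over a field these are automatically linear subspaces, so no separate
  closure under scalars is required.\<close>

definition two_sided_ideal :: "'a::ring_1 set \<Rightarrow> bool" where
  "two_sided_ideal I \<longleftrightarrow> 0 \<in> I \<and> (\<forall>x\<in>I. \<forall>y\<in>I. x + y \<in> I)
     \<and> (\<forall>a. \<forall>x\<in>I. a * x \<in> I \<and> x * a \<in> I)"

definition ideal_generated :: "'a::ring_1 set \<Rightarrow> 'a set" where
  "ideal_generated S = \<Inter>{I. two_sided_ideal I \<and> S \<subseteq> I}"

lemma two_sided_ideal_ideal_generated: "two_sided_ideal (ideal_generated S)"
  unfolding two_sided_ideal_def ideal_generated_def by blast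

lemma ideal_generated_superset: "S \<subseteq> ideal_generated S"
  unfolding ideal_generated_def by blast

lemma two_sided_ideal_zero: "two_sided_ideal I \<Longrightarrow> 0 \<in> I"
  and two_sided_ideal_add: "two_sided_ideal I \<Longrightarrow> x \<in> I \<Longrightarrow> y \<in> I \<Longrightarrow> x + y \<in> I"
  and two_sided_ideal_mult_left: "two_sided_ideal I \<Longrightarrow> x \<in> I \<Longrightarrow> a * x \<in> I"
  and two_sided_ideal_mult_right: "two_sided_ideal I \<Longrightarrow> x \<in> I \<Longrightarrow> x * a \<in> I"
  unfolding two_sided_ideal_def by auto

lemma two_sided_ideal_uminus: "two_sided_ideal I \<Longrightarrow> x \<in> I \<Longrightarrow> - x \<in> I"
  using two_sided_ideal_mult_left[of I x "-1"] by simp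

section \<open>The free associative unital algebra\<close>

text \<open>The free monoid on \<open>'g\<close>, written additively because \<open>'a \<Rightarrow>\<^sub>0 'k\<close> is the monoid algebra
  (convolution product) of an additively written monoid. Hence \<open>'g word \<Rightarrow>\<^sub>0 'k\<close> is the free
  associative unital \<open>'k\<close>-algebra on \<open>'g\<close>.\<close>

datatype 'g word = Word (letters: "'g list")

instantiation word :: (type) monoid_add
begin

definition zero_word :: "'a word" where
  "0 = Word []"

definition plus_word :: "'a word \<Rightarrow> 'a word \<Rightarrow> 'a word" where
  "u + v = Word (letters u @ letters v)"

instance
  by standard (simp_all add: zero_word_def plus_word_def)

end

definition free_gen :: "'g \<Rightarrow> ('g word \<Rightarrow>\<^sub>0 'k::field)" where
  "free_gen g = Poly_Mapping.single (Word [g]) 1"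

lemma free_algebra_induct [case_names single add]:
  assumes single: "\<And>w c. P (Poly_Mapping.single w c)"
    and add: "\<And>x y. P x \<Longrightarrow> P y \<Longrightarrow> P (x + y)"
  shows "P (x :: 'a \<Rightarrow>\<^sub>0 'k::comm_monoid_add)"
proof (induction x rule: update_induct)
  case const
  show ?case using single[of undefined 0] by simp
next
  case (update f a b)
  have "Poly_Mapping.update a b f = Poly_Mapping.single a b + f"
    using update(1)
    by (intro poly_mapping_eqI)
      (auto simp: lookup_update lookup_add lookup_single in_keys_iff when_def)
  then show ?case using single add update(3) by metis
qed

lemma single_zero_commute:
  fixes x :: "'a::monoid_add \<Rightarrow>\<^sub>0 'k::comm_ring_1"
  shows "Poly_Mapping.single 0 c * x = x * Poly_Mapping.single 0 c"
  by (induction x rule: free_algebra_induct)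
    (simp_all add: mult_single mult.commute distrib_left distrib_right)

lemma lookup_mult_empty_word:
  fixes x y :: "'g word \<Rightarrow>\<^sub>0 'k::comm_ring_1"
  shows "Poly_Mapping.lookup (x * y) 0 = Poly_Mapping.lookup x 0 * Poly_Mapping.lookup y 0"
proof (induction x rule: free_algebra_induct)
  case (single u c)
  show ?case
  proof (induction y rule: free_algebra_induct)
    case (single v d)
    have "u + v = 0 \<longleftrightarrow> u = 0 \<and> v = 0"
      by (cases u; cases v) (simp add: plus_word_def zero_word_def)
    then show ?case by (auto simp: mult_single lookup_single when_def)
  qed (simp add: distrib_left lookup_add)
qed (simp add: distrib_right lookup_add)

section \<open>The algebra \<open>U\<^sub>n\<close>\<close>

text \<open>The indices \<open>1, \<dots>, n\<close> are the elements of a finite type \<open>'n\<close> with \<open>CARD('n) = n\<close>.\<close>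

datatype 'n gen = GenL 'n | GenR 'n

definition relators :: "('n gen word \<Rightarrow>\<^sub>0 'k::field) set" where
  "relators =
     {free_gen (GenL i) * free_gen (GenL j) - free_gen (GenL j) * free_gen (GenL i) | i j. True} \<union>
     {free_gen (GenR i) * free_gen (GenL j)
        - (free_gen (GenL j) * free_gen (GenR i) + free_gen (GenR i) * free_gen (GenR j)) | i j. True}"

definition U_rel :: "('n gen word \<Rightarrow>\<^sub>0 'k::field) \<Rightarrow> ('n gen word \<Rightarrow>\<^sub>0 'k) \<Rightarrow> bool" where
  "U_rel x y \<longleftrightarrow> x - y \<in> ideal_generated relators"

lemma equivp_U_rel: "equivp U_rel"
proof (rule equivpI)
  note I = two_sided_ideal_ideal_generated[of "relators :: ('n gen word \<Rightarrow>\<^sub>0 'k::field) set"]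
  show "reflp (U_rel :: ('n gen word \<Rightarrow>\<^sub>0 'k::field) \<Rightarrow> _)"
    by (simp add: reflp_def U_rel_def two_sided_ideal_zero[OF I])
  show "symp (U_rel :: ('n gen word \<Rightarrow>\<^sub>0 'k::field) \<Rightarrow> _)"
    unfolding symp_def U_rel_def by (metis minus_diff_eq two_sided_ideal_uminus[OF I])
  show "transp (U_rel :: ('n gen word \<Rightarrow>\<^sub>0 'k::field) \<Rightarrow> _)"
  proof (rule transpI)
    fix x y z :: "'n gen word \<Rightarrow>\<^sub>0 'k"
    assume "U_rel x y" "U_rel y z"
    then have "(x - y) + (y - z) \<in> ideal_generated relators"
      unfolding U_rel_def by (rule two_sided_ideal_add[OF I])
    then show "U_rel x z"
      unfolding U_rel_def by simp
  qed
qed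

lemma one_not_in_relator_ideal:
  "(1 :: 'n gen word \<Rightarrow>\<^sub>0 'k::field) \<notin> ideal_generated relators"
proof
  let ?I = "{x :: 'n gen word \<Rightarrow>\<^sub>0 'k. Poly_Mapping.lookup x 0 = 0}"
  have "Poly_Mapping.lookup (free_gen g :: 'n gen word \<Rightarrow>\<^sub>0 'k) 0 = 0" for g
    by (simp add: free_gen_def lookup_single zero_word_def)
  then have "relators \<subseteq> ?I"
    by (auto simp: relators_def lookup_minus lookup_add lookup_mult_empty_word)
  moreover have "two_sided_ideal ?I"
    by (auto simp: two_sided_ideal_def lookup_add lookup_mult_empty_word)
  ultimately have "ideal_generated relators \<subseteq> ?I"
    unfolding ideal_generated_def by blast
  moreover assume "(1 :: 'n gen word \<Rightarrow>\<^sub>0 'k) \<in> ideal_generated relators"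
  ultimately show False by auto
qed

quotient_type (overloaded) ('k, 'n) U = "'n gen word \<Rightarrow>\<^sub>0 ('k::field)" / U_rel
  by (rule equivp_U_rel)

instantiation U :: (field, type) ring_1
begin

lift_definition zero_U :: "('a, 'b) U" is 0 .

lift_definition one_U :: "('a, 'b) U" is 1 .

lift_definition plus_U :: "('a, 'b) U \<Rightarrow> ('a, 'b) U \<Rightarrow> ('a, 'b) U" is "(+)"
proof -
  fix x x' y y' :: "'b gen word \<Rightarrow>\<^sub>0 'a"
  assume "U_rel x x'" "U_rel y y'"
  then have "(x - x') + (y - y') \<in> ideal_generated relators"
    unfolding U_rel_def by (rule two_sided_ideal_add[OF two_sided_ideal_ideal_generated])
  then show "U_rel (x + y) (x' + y')"
    unfolding U_rel_def by (simp add: algebra_simps)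
qed

lift_definition uminus_U :: "('a, 'b) U \<Rightarrow> ('a, 'b) U" is uminus
proof -
  fix x x' :: "'b gen word \<Rightarrow>\<^sub>0 'a"
  assume "U_rel x x'"
  then have "- (x - x') \<in> ideal_generated relators"
    unfolding U_rel_def by (rule two_sided_ideal_uminus[OF two_sided_ideal_ideal_generated])
  then show "U_rel (- x) (- x')"
    unfolding U_rel_def by simp
qed

lift_definition minus_U :: "('a, 'b) U \<Rightarrow> ('a, 'b) U \<Rightarrow> ('a, 'b) U" is "(-)"
proof -
  fix x x' y y' :: "'b gen word \<Rightarrow>\<^sub>0 'a"
  assume "U_rel x x'" "U_rel y y'"
  then have "(x - x') + - (y - y') \<in> ideal_generated relators"
    unfolding U_rel_def
    by (intro two_sided_ideal_add two_sided_ideal_uminus two_sided_ideal_ideal_generated)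
  then show "U_rel (x - y) (x' - y')"
    unfolding U_rel_def by (simp add: algebra_simps)
qed

lift_definition times_U :: "('a, 'b) U \<Rightarrow> ('a, 'b) U \<Rightarrow> ('a, 'b) U" is "(*)"
proof -
  fix x x' y y' :: "'b gen word \<Rightarrow>\<^sub>0 'a"
  assume "U_rel x x'" "U_rel y y'"
  then have "(x - x') * y + x' * (y - y') \<in> ideal_generated relators"
    unfolding U_rel_def
    by (intro two_sided_ideal_add two_sided_ideal_mult_left two_sided_ideal_mult_right
        two_sided_ideal_ideal_generated)
  then show "U_rel (x * y) (x' * y')"
    unfolding U_rel_def by (simp add: algebra_simps)
qed

instance
proof
  note I = two_sided_ideal_ideal_generated[of "relators :: ('b gen word \<Rightarrow>\<^sub>0 'a) set"]
  fix a b c :: "('a, 'b) U"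
  show "a + b + c = a + (b + c)" "a + b = b + a" "0 + a = a" "- a + a = 0" "a - b = a + - b"
    "a * b * c = a * (b * c)" "(a + b) * c = a * c + b * c" "a * (b + c) = a * b + a * c"
    "1 * a = a" "a * 1 = a"
    by (transfer, simp add: U_rel_def algebra_simps two_sided_ideal_zero[OF I])+
  show "(0 :: ('a, 'b) U) \<noteq> 1"
  proof (transfer, rule notI)
    assume "U_rel (0 :: 'b gen word \<Rightarrow>\<^sub>0 'a) 1"
    then have "- (0 - 1) \<in> ideal_generated (relators :: ('b gen word \<Rightarrow>\<^sub>0 'a) set)"
      unfolding U_rel_def by (rule two_sided_ideal_uminus[OF I])
    then show False by (simp add: one_not_in_relator_ideal)
  qed
qed

end

lift_definition U_scale :: "'k::field \<Rightarrow> ('k, 'n) U \<Rightarrow> ('k, 'n) U"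
  is "\<lambda>c x. Poly_Mapping.single 0 c * x"
  unfolding U_rel_def right_diff_distrib [symmetric]
  by (rule two_sided_ideal_mult_left[OF two_sided_ideal_ideal_generated])

interpretation U: vector_space "U_scale :: 'k::field \<Rightarrow> ('k, 'n) U \<Rightarrow> ('k, 'n) U"
proof
  note I = two_sided_ideal_ideal_generated[of "relators :: ('n gen word \<Rightarrow>\<^sub>0 'k) set"]
  fix a b :: 'k and x y :: "('k, 'n) U"
  show "U_scale a (x + y) = U_scale a x + U_scale a y"
    by transfer (simp add: U_rel_def algebra_simps two_sided_ideal_zero[OF I])
  show "U_scale (a + b) x = U_scale a x + U_scale b x"
    by transfer (simp add: U_rel_def algebra_simps single_add two_sided_ideal_zero[OF I])
  show "U_scale a (U_scale b x) = U_scale (a * b) x"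
    by transfer
      (simp add: U_rel_def mult_single mult.assoc [symmetric] two_sided_ideal_zero[OF I])
  show "U_scale 1 x = x"
    by transfer (simp add: U_rel_def two_sided_ideal_zero[OF I])
qed

lemma U_scale_mult_left: "U_scale c (x * y) = U_scale c x * y"
  by transfer
    (simp add: U_rel_def mult.assoc two_sided_ideal_zero[OF two_sided_ideal_ideal_generated])

lemma U_scale_mult_right: "U_scale c (x * y) = x * U_scale c y"
proof (transfer, unfold U_rel_def)
  fix c and x y :: "'n gen word \<Rightarrow>\<^sub>0 'k::field"
  have "Poly_Mapping.single 0 c * (x * y) = x * (Poly_Mapping.single 0 c * y)"
    by (metis mult.assoc single_zero_commute)
  then show "Poly_Mapping.single 0 c * (x * y) - x * (Poly_Mapping.single 0 c * y)
      \<in> ideal_generated relators"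
    by (simp add: two_sided_ideal_zero[OF two_sided_ideal_ideal_generated])
qed

lift_definition U_l :: "'n \<Rightarrow> ('k::field, 'n) U" is "\<lambda>i. free_gen (GenL i)" .

lift_definition U_r :: "'n \<Rightarrow> ('k::field, 'n) U" is "\<lambda>i. free_gen (GenR i)" .

lemma U_l_commute: "U_l i * U_l j = (U_l j * U_l i :: ('k::field, 'n) U)"
  by transfer
    (unfold U_rel_def relators_def, rule ideal_generated_superset[THEN subsetD], blast)

lemma U_r_U_l: "U_r i * U_l j = (U_l j * U_r i + U_r i * U_r j :: ('k::field, 'n) U)"
  by transfer
    (unfold U_rel_def relators_def, rule ideal_generated_superset[THEN subsetD], blast)

definition U_ideal :: "('k::field, 'n) U set" where
  "U_ideal = ideal_generated (range U_r)"

section \<open>Derivations\<close>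

definition derivation :: "(('k::field, 'n) U \<Rightarrow> ('k, 'n) U) \<Rightarrow> bool" where
  "derivation D \<longleftrightarrow>
     Vector_Spaces.linear U_scale U_scale D \<and> (\<forall>x y. D (x * y) = D x * y + x * D y)"

definition locally_nilpotent :: "('a::zero \<Rightarrow> 'a) \<Rightarrow> bool" where
  "locally_nilpotent D \<longleftrightarrow> (\<forall>a. \<exists>m. (D ^^ m) a = 0)"

end

theory Submission
  imports Defs "HOL-Library.Multiset_Order"
begin

text \<open>In the basis of products of a monomial in the \<open>l\<^sub>i\<close> with a word in the \<open>r\<^sub>i\<close>, the commutator
  with \<open>l\<^sub>j\<close> keeps the first letter of a word and shuffles \<open>r\<^sub>j\<close> into the rest. In characteristic
  \<open>0\<close> multiplication by letters in the shuffle algebra and the operators stripping a first letter satisfy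
  the relations of a Weyl algebra, so the elements \<open>D(l\<^sub>i)\<close>, which satisfy
  \<open>[D(l\<^sub>i), l\<^sub>j] = [D(l\<^sub>j), l\<^sub>i]\<close>, have the form \<open>[u, l\<^sub>i]\<close> with a common \<open>u\<close> in the ideal (this uses
  \<open>n \<ge> 2\<close>). Subtracting the inner derivation of \<open>u\<close> gives a derivation \<open>E\<close> vanishing on all \<open>l\<^sub>i\<close>;
  the relations force \<open>E = 0\<close> or lowest terms \<open>E(r\<^sub>i) = r\<^sub>i h + \<dots>\<close> with one \<open>h = \<Sum> h\<^sub>k r\<^sub>k \<noteq> 0\<close>.
  In the second case the coefficient of \<open>r\<^sub>k^(m+1)\<close> in \<open>D^m(r\<^sub>k)\<close> is \<open>m! h\<^sub>k^m \<noteq> 0\<close>. In the first case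
  \<open>D = [u, _]\<close>, and if \<open>D^m(r\<^sub>i) = 0\<close> then \<open>u y = \<plusminus> r\<^sub>i u^m\<close> for some \<open>y\<close>, which for \<open>u \<noteq> 0\<close> is
  impossible when \<open>r\<^sub>i\<close> differs from the first letter of a lowest term of \<open>u\<close>.\<close>

section \<open>Extension of maps from monomials\<close>

text \<open>\<open>F\<close> receives a monomial together with its coefficient, so the target needs
  only an addition; no scalar action on it is assumed.\<close>

definition extend :: "('a \<Rightarrow> 'b::zero \<Rightarrow> 'c::comm_monoid_add) \<Rightarrow> ('a \<Rightarrow>\<^sub>0 'b) \<Rightarrow> 'c" where
  "extend F x = (\<Sum>a\<in>Poly_Mapping.keys x. F a (Poly_Mapping.lookup x a))"

lemma extend_zero [simp]: "extend F 0 = 0"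
  by (simp add: extend_def)

lemma extend_single: "F a 0 = 0 \<Longrightarrow> extend F (Poly_Mapping.single a b) = F a b"
  by (simp add: extend_def)

lemma extend_add:
  assumes "\<And>a. F a 0 = 0" "\<And>a b c. F a (b + c) = F a b + F a c"
  shows "extend F (x + y) = extend F x + extend F y"
  unfolding extend_def by (rule setsum_keys_plus_distrib) (simp_all add: assms)

section \<open>Shuffling and stripping letters in the free algebra\<close>

type_synonym ('n, 'l) free = "'n word \<Rightarrow>\<^sub>0 'l"

text \<open>Coefficients enter as multiples of the empty word. They are central, so linearity over
  the coefficient ring becomes arithmetic inside one ring.\<close>

definition scalar :: "'l::comm_ring_1 \<Rightarrow> ('n word \<Rightarrow>\<^sub>0 'l)" where
  "scalar p = Poly_Mapping.single 0 p"

definition letter :: "'n \<Rightarrow> ('n word \<Rightarrow>\<^sub>0 'l::comm_ring_1)" where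
  "letter i = Poly_Mapping.single (Word [i]) 1"

abbreviation monomial :: "'n list \<Rightarrow> ('n word \<Rightarrow>\<^sub>0 'l::comm_ring_1)" where
  "monomial w \<equiv> Poly_Mapping.single (Word w) 1"

lemma scalar_add: "scalar (p + q) = scalar p + scalar q"
  and scalar_mult: "scalar (p * q) = scalar p * scalar q"
  and scalar_zero [simp]: "scalar 0 = 0"
  and scalar_one [simp]: "scalar 1 = 1"
  by (simp_all add: scalar_def single_add mult_single)

lemma scalar_of_nat: "scalar (of_nat m) = of_nat m"
  by (simp add: scalar_def)

lemma mult_scalar: "x * scalar p = scalar p * x"
  unfolding scalar_def by (rule single_zero_commute [symmetric])

lemma mult_scalar_assoc: "x * (scalar p * y) = scalar p * (x * y)"
  by (metis mult.assoc mult_scalar)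

lemma scalar_left_commute: "scalar p * (scalar q * x) = scalar q * (scalar p * x)"
  by (rule mult_scalar_assoc)

lemma monomial_Nil: "monomial [] = 1"
  by (simp flip: zero_word_def)

lemma monomial_Cons: "monomial (i # w) = letter i * monomial w"
  by (simp add: letter_def mult_single plus_word_def)

lemma monomial_append: "monomial (v @ w) = monomial v * monomial w"
  by (simp add: mult_single plus_word_def)

lemma single_Word: "Poly_Mapping.single (Word w) p = scalar p * monomial w"
  by (simp add: scalar_def mult_single)

lemma free_induct [case_names monomial add]:
  assumes "\<And>w p. P (scalar p * monomial w)" "\<And>x y. P x \<Longrightarrow> P y \<Longrightarrow> P (x + y)"
  shows "P x"
proof (induction x rule: free_algebra_induct)
  case (single w p)
  have "scalar p * monomial (letters w) = Poly_Mapping.single w p"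
    by (simp add: scalar_def mult_single)
  then show ?case using assms(1)[of p "letters w"] by metis
qed (rule assms(2))

section \<open>Coefficient-linear maps given on words\<close>

definition linear_extend ::
  "('n list \<Rightarrow> ('m word \<Rightarrow>\<^sub>0 'l::comm_ring_1)) \<Rightarrow> ('n word \<Rightarrow>\<^sub>0 'l) \<Rightarrow> ('m word \<Rightarrow>\<^sub>0 'l)"
  where
  "linear_extend F = extend (\<lambda>w p. scalar p * F (letters w))"

definition scalar_linear :: "(('n word \<Rightarrow>\<^sub>0 'l::comm_ring_1) \<Rightarrow> ('m word \<Rightarrow>\<^sub>0 'l)) \<Rightarrow> bool" where
  "scalar_linear f \<longleftrightarrow> (\<forall>x y. f (x + y) = f x + f y) \<and> (\<forall>p x. f (scalar p * x) = scalar p * f x)"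

lemma scalar_linear_add: "scalar_linear f \<Longrightarrow> f (x + y) = f x + f y"
  and scalar_linear_scalar: "scalar_linear f \<Longrightarrow> f (scalar p * x) = scalar p * f x"
  by (simp_all add: scalar_linear_def)

lemma scalar_linear_zero: "scalar_linear f \<Longrightarrow> f 0 = 0"
  using scalar_linear_add[of f 0 0] by simp

lemma scalar_linear_uminus: "scalar_linear f \<Longrightarrow> f (- x) = - f x"
  using scalar_linear_add[of f x "- x"] scalar_linear_zero[of f] by (simp add: eq_neg_iff_add_eq_0 add.commute)

lemma scalar_linear_diff: "scalar_linear f \<Longrightarrow> f (x - y) = f x - f y"
  using scalar_linear_add[of f x "- y"] by (simp add: scalar_linear_uminus)

lemma scalar_linear_of_nat: "scalar_linear f \<Longrightarrow> f (of_nat m * x) = of_nat m * f x"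
  using scalar_linear_scalar[of f "of_nat m" x] by (simp add: scalar_of_nat)

lemma scalar_linear_sum: "scalar_linear f \<Longrightarrow> f (sum g A) = (\<Sum>a\<in>A. f (g a))"
  by (induction A rule: infinite_finite_induct) (simp_all add: scalar_linear_zero scalar_linear_add)

lemma scalar_linear_linear_extend [simp]: "scalar_linear (linear_extend F)"
proof -
  have add: "linear_extend F (x + y) = linear_extend F x + linear_extend F y" for x y
    unfolding linear_extend_def by (rule extend_add) (simp_all add: scalar_add distrib_right)
  have "linear_extend F (scalar p * x) = scalar p * linear_extend F x" for p x
  proof (induction x rule: free_algebra_induct)
    case (single w q)
    have "scalar p * Poly_Mapping.single w q = Poly_Mapping.single w (p * q)"
      by (simp add: scalar_def mult_single)
    then show ?case
      by (simp add: linear_extend_def extend_single scalar_mult mult.assoc)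
  qed (simp add: add distrib_left)
  with add show ?thesis by (simp add: scalar_linear_def)
qed

lemma linear_extend_monomial [simp]: "linear_extend F (monomial w) = F w"
  by (simp add: linear_extend_def extend_single)

lemma scalar_linear_eqI:
  assumes "scalar_linear f" "scalar_linear g" "\<And>w. f (monomial w) = g (monomial w)"
  shows "f x = g x"
  by (induction x rule: free_induct) (simp_all add: assms scalar_linear_add scalar_linear_scalar)

named_theorems linear_simps

text \<open>\<open>ad_l j\<close> describes the commutator \<open>x \<mapsto> x l\<^sub>j - l\<^sub>j x\<close> of \<open>U\<^sub>n\<close> in normal form
  coordinates; it is the derivation with \<open>r\<^sub>i \<mapsto> r\<^sub>i r\<^sub>j\<close>.\<close>

primrec ad_l_word :: "'n \<Rightarrow> 'n list \<Rightarrow> ('n word \<Rightarrow>\<^sub>0 'l::comm_ring_1)" where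
  "ad_l_word j [] = 0"
| "ad_l_word j (i # w) = letter i * (letter j * monomial w + ad_l_word j w)"

definition ad_l :: "'n \<Rightarrow> ('n word \<Rightarrow>\<^sub>0 'l::comm_ring_1) \<Rightarrow> ('n word \<Rightarrow>\<^sub>0 'l)" where
  "ad_l j = linear_extend (ad_l_word j)"

text \<open>\<open>ad_l j\<close> inserts \<open>j\<close> after each letter of a word; adding the word with \<open>j\<close> in front gives the
  shuffle product with \<open>j\<close>.\<close>

definition shuffle_letter :: "'n \<Rightarrow> ('n word \<Rightarrow>\<^sub>0 'l::comm_ring_1) \<Rightarrow> ('n word \<Rightarrow>\<^sub>0 'l)" where
  "shuffle_letter j x = letter j * x + ad_l j x"

definition strip :: "'n \<Rightarrow> ('n word \<Rightarrow>\<^sub>0 'l::comm_ring_1) \<Rightarrow> ('n word \<Rightarrow>\<^sub>0 'l)" where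
  "strip i = linear_extend (\<lambda>w. if w \<noteq> [] \<and> hd w = i then monomial (tl w) else 0)"

text \<open>The constant term stays inside the free algebra, so that this map is itself linear over
  the coefficients and its values can multiply words.\<close>

definition const_coeff :: "('n word \<Rightarrow>\<^sub>0 'l::comm_ring_1) \<Rightarrow> ('n word \<Rightarrow>\<^sub>0 'l)" where
  "const_coeff = linear_extend (\<lambda>w. if w = [] then 1 else 0)"

lemma scalar_linear_ad_l [simp]: "scalar_linear (ad_l j)"
  and scalar_linear_strip [simp]: "scalar_linear (strip j)"
  and scalar_linear_const_coeff [simp]: "scalar_linear const_coeff"
  by (simp_all add: ad_l_def strip_def const_coeff_def)

lemmas [linear_simps] =
  scalar_linear_ad_l [THEN scalar_linear_add] scalar_linear_ad_l [THEN scalar_linear_scalar]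
  scalar_linear_strip [THEN scalar_linear_add] scalar_linear_strip [THEN scalar_linear_scalar]
  scalar_linear_const_coeff [THEN scalar_linear_add] scalar_linear_const_coeff [THEN scalar_linear_scalar]

lemma scalar_linear_shuffle_letter [simp]: "scalar_linear (shuffle_letter j)"
  by (simp add: scalar_linear_def shuffle_letter_def linear_simps algebra_simps mult_scalar_assoc)

lemmas [linear_simps] =
  scalar_linear_shuffle_letter [THEN scalar_linear_add]
  scalar_linear_shuffle_letter [THEN scalar_linear_scalar]

lemma ad_l_monomial: "ad_l j (monomial w) = ad_l_word j w"
  by (simp add: ad_l_def)

lemma ad_l_one [simp]: "ad_l j 1 = 0"
  using ad_l_monomial[of j "[]"] by (simp add: monomial_Nil)

text \<open>Inserting after each letter includes the place right behind the first one, which is the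
  front of the remainder; hence a full shuffle there.\<close>

lemma ad_l_letter_mult: "ad_l j (letter i * x) = letter i * shuffle_letter j x"
  for x :: "('n, 'l::comm_ring_1) free"
proof (rule scalar_linear_eqI[where f = "\<lambda>x. ad_l j (letter i * x)"])
  show "ad_l j (letter i * monomial w) = letter i * shuffle_letter j (monomial w :: ('n, 'l) free)"
    for w :: "'n list"
    by (simp add: ad_l_monomial shuffle_letter_def flip: monomial_Cons)
qed (simp_all add: scalar_linear_def linear_simps algebra_simps mult_scalar_assoc)

lemma ad_l_letter: "ad_l j (letter i) = letter i * letter j"
  using ad_l_letter_mult[of j i 1] by (simp add: shuffle_letter_def)

lemma ad_l_mult: "ad_l j (x * y) = ad_l j x * y + x * ad_l j y"
  for x :: "('n, 'l::comm_ring_1) free"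
proof -
  have *: "ad_l j (monomial w * y) = ad_l j (monomial w :: ('n, 'l) free) * y + monomial w * ad_l j y"
    for w :: "'n list"
  proof (induction w)
    case Nil
    show ?case by (simp add: monomial_Nil)
  next
    case (Cons i w)
    show ?case
      by (simp add: monomial_Cons ad_l_letter_mult shuffle_letter_def mult.assoc Cons algebra_simps)
  qed
  show ?thesis
    by (rule scalar_linear_eqI[where f = "\<lambda>x. ad_l j (x * y)"])
      (simp_all add: * scalar_linear_def linear_simps algebra_simps mult_scalar_assoc)
qed

lemma ad_l_commute: "ad_l i (ad_l j x) = ad_l j (ad_l i x)"
  for x :: "('n, 'l::comm_ring_1) free"
proof (rule scalar_linear_eqI[where f = "\<lambda>x. ad_l i (ad_l j x)"])
  show "ad_l i (ad_l j (monomial w :: ('n, 'l) free)) = ad_l j (ad_l i (monomial w))"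
    for w :: "'n list"
    by (induction w)
      (simp_all add: monomial_Nil monomial_Cons ad_l_letter_mult shuffle_letter_def
        scalar_linear_add scalar_linear_zero algebra_simps)
qed (simp_all add: scalar_linear_def linear_simps algebra_simps mult_scalar_assoc)

lemma strip_one [simp]: "strip i 1 = 0"
  unfolding strip_def by (simp flip: monomial_Nil)

lemma strip_letter_mult: "strip i (letter j * x) = (if i = j then x else 0)"
  for x :: "('n, 'l::comm_ring_1) free"
proof (rule scalar_linear_eqI[where f = "\<lambda>x. strip i (letter j * x)" and g = "\<lambda>x. if i = j then x else 0"])
  show "strip i (letter j * (monomial w :: ('n, 'l) free)) = (if i = j then monomial w else 0)"
    for w :: "'n list"
    by (simp add: strip_def flip: monomial_Cons)
qed (simp_all add: scalar_linear_def linear_simps algebra_simps mult_scalar_assoc)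

lemma strip_letter: "strip i (letter j) = (if i = j then 1 else 0)"
  using strip_letter_mult[of i j 1] by simp

lemma const_coeff_one [simp]: "const_coeff 1 = 1"
  unfolding const_coeff_def by (simp flip: monomial_Nil)

lemma const_coeff_letter_mult [simp]: "const_coeff (letter j * x) = 0"
  for x :: "('n, 'l::comm_ring_1) free"
proof (rule scalar_linear_eqI[where f = "\<lambda>x. const_coeff (letter j * x)" and g = "\<lambda>x. 0"])
  show "const_coeff (letter j * (monomial w :: ('n, 'l) free)) = 0" for w :: "'n list"
    by (simp add: const_coeff_def flip: monomial_Cons)
qed (simp_all add: scalar_linear_def linear_simps algebra_simps mult_scalar_assoc)

lemma const_coeff_scalar [simp]: "const_coeff (scalar p) = scalar p"
  using scalar_linear_scalar[of const_coeff p 1] by simp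

lemma strip_scalar [simp]: "strip i (scalar p) = 0"
  using scalar_linear_scalar[of "strip i" p 1] by simp

lemma const_coeff_eq_scalar: "const_coeff x = scalar (Poly_Mapping.lookup x 0)"
proof (induction x rule: free_induct)
  case (monomial w p)
  show ?case
    by (cases w)
      (simp_all add: linear_simps monomial_Nil monomial_Cons lookup_mult_empty_word,
        simp_all add: scalar_def letter_def lookup_single zero_word_def)
qed (simp add: scalar_linear_add lookup_add scalar_add)

lemma strip_const_coeff [simp]: "strip i (const_coeff x) = 0"
  by (simp add: const_coeff_eq_scalar)

lemma const_coeff_mult: "const_coeff (x * y) = const_coeff x * const_coeff y"
  by (simp add: const_coeff_eq_scalar lookup_mult_empty_word scalar_mult)

lemma const_coeff_letter [simp]: "const_coeff (letter j) = 0"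
  using const_coeff_letter_mult[of j 1] by simp

text \<open>Only a constant term of \<open>x\<close> lets the first letter of \<open>y\<close> come
  to the front.\<close>

lemma strip_mult: "strip i (x * y) = strip i x * y + const_coeff x * strip i y"
  for x :: "('n, 'l::comm_ring_1) free"
proof (rule scalar_linear_eqI[where f = "\<lambda>x. strip i (x * y)"])
  show "strip i (monomial w * y) = strip i (monomial w :: ('n, 'l) free) * y +
      const_coeff (monomial w) * strip i y"
    for w :: "'n list"
    by (cases w) (simp_all add: monomial_Nil monomial_Cons mult.assoc strip_letter_mult)
qed (simp_all add: scalar_linear_def linear_simps algebra_simps mult_scalar_assoc)

lemma const_coeff_ad_l [simp]: "const_coeff (ad_l j x) = 0"
  for x :: "('n, 'l::comm_ring_1) free"
proof (rule scalar_linear_eqI[where f = "\<lambda>x. const_coeff (ad_l j x)" and g = "\<lambda>x. 0"])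
  show "const_coeff (ad_l j (monomial w :: ('n, 'l) free)) = 0" for w :: "'n list"
    by (cases w) (simp_all add: monomial_Nil monomial_Cons ad_l_letter_mult scalar_linear_zero)
qed (simp_all add: scalar_linear_def linear_simps algebra_simps mult_scalar_assoc)

lemma strip_ad_l: "strip i (ad_l j x) = shuffle_letter j (strip i x)"
  for x :: "('n, 'l::comm_ring_1) free"
proof (rule scalar_linear_eqI[where f = "\<lambda>x. strip i (ad_l j x)"])
  show "strip i (ad_l j (monomial w :: ('n, 'l) free)) = shuffle_letter j (strip i (monomial w))"
    for w :: "'n list"
    by (cases w) (simp_all add: monomial_Nil scalar_linear_zero monomial_Cons ad_l_letter_mult strip_letter_mult)
qed (simp_all add: scalar_linear_def linear_simps algebra_simps mult_scalar_assoc)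

text \<open>The Weyl relation: \<open>strip i\<close> acts as a derivation of the shuffle product
  that sends the letter i to 1 and all other letters to 0.\<close>

lemma strip_shuffle_letter:
  "strip i (shuffle_letter j x) = (if i = j then x else 0) + shuffle_letter j (strip i x)"
  by (simp add: shuffle_letter_def[of j x] scalar_linear_add strip_ad_l strip_letter_mult)

lemma free_decompose:
  fixes x :: "'n::finite word \<Rightarrow>\<^sub>0 'l::comm_ring_1"
  shows "x = const_coeff x + (\<Sum>i\<in>UNIV. letter i * strip i x)"
proof (rule scalar_linear_eqI[where f = "\<lambda>x. x"])
  show "monomial w = const_coeff (monomial w :: ('n, 'l) free) + (\<Sum>i\<in>UNIV. letter i * strip i (monomial w))"
    for w :: "'n list"
    by (cases w) (simp_all add: monomial_Nil monomial_Cons strip_letter_mult if_distrib[of "\<lambda>x. _ * x"] cong: if_cong)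
  show "scalar_linear (\<lambda>x :: 'n word \<Rightarrow>\<^sub>0 'l. const_coeff x + (\<Sum>i\<in>UNIV. letter i * strip i x))"
    unfolding scalar_linear_def
  proof (intro conjI allI)
    fix x y :: "('n, 'l) free" and p
    show "const_coeff (x + y) + (\<Sum>i\<in>UNIV. letter i * strip i (x + y)) =
      const_coeff x + (\<Sum>i\<in>UNIV. letter i * strip i x) +
      (const_coeff y + (\<Sum>i\<in>UNIV. letter i * strip i y))"
      by (simp add: scalar_linear_add distrib_left sum.distrib)
    show "const_coeff (scalar p * x) + (\<Sum>i\<in>UNIV. letter i * strip i (scalar p * x)) =
      scalar p * (const_coeff x + (\<Sum>i\<in>UNIV. letter i * strip i x))"
      by (simp add: scalar_linear_scalar distrib_left sum_distrib_left mult_scalar_assoc)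
  qed
qed (simp add: scalar_linear_def)

lemma strip_eqI:
  fixes x y :: "'n::finite word \<Rightarrow>\<^sub>0 'l::comm_ring_1"
  assumes "const_coeff x = const_coeff y" "\<And>i. strip i x = strip i y"
  shows "x = y"
  by (subst free_decompose[of x], subst free_decompose[of y]) (simp add: assms)

lemma strip_nilpotent: "\<exists>M. (strip i ^^ M) x = 0"
  for x :: "('n, 'l::comm_ring_1) free"
proof -
  have lin: "scalar_linear (strip i ^^ m :: ('n, 'l) free \<Rightarrow> _)" for m
    by (induction m) (auto simp: scalar_linear_def linear_simps algebra_simps mult_scalar_assoc)
  have mono: "(strip i ^^ m) (monomial w :: ('n, 'l) free) = 0" if "length w < m" for m w
    using that
  proof (induction m arbitrary: w)
    case (Suc m)
    then show ?case
      by (cases w)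
        (auto simp: funpow_Suc_right monomial_Nil monomial_Cons strip_letter_mult
          scalar_linear_zero[OF lin] simp del: funpow.simps)
  qed simp
  \<comment> \<open>Vanishing for all large exponents, not just for one, so that the larger bound
    serves a sum.\<close>
  have "\<exists>M. \<forall>m\<ge>M. (strip i ^^ m) x = 0"
  proof (induction x rule: free_induct)
    case (monomial w p)
    have "(strip i ^^ m) (scalar p * monomial w) = 0" if "Suc (length w) \<le> m" for m
      using mono[of w m] that by (simp add: scalar_linear_scalar[OF lin])
    then show ?case by blast
  next
    case (add x y)
    then obtain M N where "\<forall>m\<ge>M. (strip i ^^ m) x = 0" "\<forall>m\<ge>N. (strip i ^^ m) y = 0" by blast
    then have "\<forall>m\<ge>max M N. (strip i ^^ m) (x + y) = 0"
      by (simp add: scalar_linear_add[OF lin])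
    then show ?case by blast
  qed
  then show ?thesis by blast
qed

section \<open>Weyl algebra arguments: injectivity and exactness of shuffling\<close>

lemma down_to_zero: "P M \<Longrightarrow> (\<And>m. P (Suc m) \<Longrightarrow> P m) \<Longrightarrow> P (0::nat)"
  by (induction M) blast+

text \<open>With a letter in front, shuffling becomes \<open>ad_l\<close>, and these operators
  commute; the letter is then stripped off again.\<close>

lemma shuffle_letter_commute: "shuffle_letter i (shuffle_letter j x) = shuffle_letter j (shuffle_letter i x)"
proof -
  have "letter i * shuffle_letter i (shuffle_letter j x) = letter i * shuffle_letter j (shuffle_letter i x)"
    by (simp only: ad_l_commute[of i j] flip: ad_l_letter_mult)
  then have "strip i (letter i * shuffle_letter i (shuffle_letter j x)) =
      strip i (letter i * shuffle_letter j (shuffle_letter i x))"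
    by (rule arg_cong)
  then show ?thesis by (simp add: strip_letter_mult)
qed

lemma strip_funpow_shuffle_letter_other:
  "i \<noteq> j \<Longrightarrow> (strip i ^^ m) (shuffle_letter j x) = shuffle_letter j ((strip i ^^ m) x)"
  by (induction m) (simp_all add: strip_shuffle_letter)

text \<open>As for d/dx and multiplication by x: [d, x] = 1 gives d^(m+1) x = x d^(m+1) + (m+1)
  d^m.\<close>

lemma strip_funpow_shuffle_letter:
  "(strip i ^^ Suc m) (shuffle_letter i x) =
    shuffle_letter i ((strip i ^^ Suc m) x) + of_nat (Suc m) * (strip i ^^ m) x"
proof (induction m)
  case (Suc m)
  have "(strip i ^^ Suc (Suc m)) (shuffle_letter i x) = strip i ((strip i ^^ Suc m) (shuffle_letter i x))"
    by simp
  also have "\<dots> = strip i (shuffle_letter i ((strip i ^^ Suc m) x)) + of_nat (Suc m) * strip i ((strip i ^^ m) x)"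
    unfolding Suc by (simp only: scalar_linear_add[OF scalar_linear_strip] scalar_linear_of_nat[OF scalar_linear_strip])
  finally show ?case
    by (simp add: strip_shuffle_letter algebra_simps)
qed (simp add: strip_shuffle_letter)

text \<open>Characteristic 0 is recorded in this form because the coefficients will be polynomials
  in the l_i, which do not form a field. It is all that the divisions by m+1 below require.\<close>

definition nat_invertible :: "'l::comm_ring_1 itself \<Rightarrow> bool" where
  "nat_invertible _ \<longleftrightarrow> (\<forall>m>0. \<exists>c::'l. c * of_nat m = 1)"

lemma nat_invertibleE:
  assumes "nat_invertible TYPE('l::comm_ring_1)"
  obtains c :: "'l::comm_ring_1" where
    "\<And>x :: ('n, 'l::comm_ring_1) free. scalar c * (of_nat (Suc m) * x) = x"
proof -
  from assms obtain c :: 'l where "c * of_nat (Suc m) = 1"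
    unfolding nat_invertible_def by blast
  then have "scalar c * (of_nat (Suc m) * x) = x" for x :: "('n, 'l) free"
    by (metis mult.assoc mult_1 scalar_mult scalar_of_nat scalar_one)
  with that show ?thesis by blast
qed

text \<open>Some power of \<open>strip i\<close> kills \<open>x\<close>. The Weyl relation lowers
  the exponent by one at the price of dividing by m+1, until \<open>x\<close> itself
  vanishes.\<close>

lemma shuffle_letter_eq_0:
  fixes x :: "('n, 'l::comm_ring_1) free"
  assumes "nat_invertible TYPE('l)" "shuffle_letter i x = 0"
  shows "x = 0"
proof -
  obtain M where M: "(strip i ^^ M) x = 0" by (rule exE[OF strip_nilpotent])
  have zero: "(strip i ^^ m) (0 :: ('n, 'l) free) = 0" for m
    by (induction m) (simp_all add: scalar_linear_zero)
  have step: "(strip i ^^ m) x = 0" if "(strip i ^^ Suc m) x = 0" for m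
  proof -
    obtain c :: 'l where c: "\<And>x :: ('n, 'l) free. scalar c * (of_nat (Suc m) * x) = x"
      using nat_invertibleE[OF assms(1)] by blast
    have "of_nat (Suc m) * (strip i ^^ m) x = 0"
      using strip_funpow_shuffle_letter[of m i x] that zero[of "Suc m"] assms(2)
      by (simp add: scalar_linear_zero)
    then show ?thesis using c[of "(strip i ^^ m) x"] by simp
  qed
  show ?thesis using down_to_zero[of "\<lambda>m. (strip i ^^ m) x = 0" M, OF M step] by simp
qed

lemma shuffle_letter_cancel:
  fixes x y :: "('n, 'l::comm_ring_1) free"
  assumes "nat_invertible TYPE('l)" "shuffle_letter i x = shuffle_letter i y"
  shows "x = y"
  using shuffle_letter_eq_0[of i "x - y"] assms by (simp add: scalar_linear_diff)

text \<open>Koszul exactness for two commuting shuffle operators, by the same descent: the power of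
  \<open>strip i\<close> that sends \<open>b\<close> to 0 lands in the image of
  \<open>shuffle_letter j\<close>, and so do all lower powers.\<close>

lemma shuffle_letter_exact:
  fixes a b :: "('n, 'l::comm_ring_1) free"
  assumes "nat_invertible TYPE('l)" "i \<noteq> j" "shuffle_letter j a = shuffle_letter i b"
  shows "\<exists>u. b = shuffle_letter j u"
proof -
  obtain M where M: "(strip i ^^ M) b = 0" by (rule exE[OF strip_nilpotent])
  have step: "\<exists>u. (strip i ^^ m) b = shuffle_letter j u"
    if "\<exists>u. (strip i ^^ Suc m) b = shuffle_letter j u" for m
  proof -
    obtain c :: 'l where c: "\<And>x :: ('n, 'l) free. scalar c * (of_nat (Suc m) * x) = x"
      using nat_invertibleE[OF assms(1)] by blast
    from that obtain u where u: "(strip i ^^ Suc m) b = shuffle_letter j u" by blast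
    \<comment> \<open>Apply \<open>strip i\<close> m+1 times to the hypothesis: it commutes with
      \<open>shuffle_letter j\<close>, while \<open>shuffle_letter i\<close> leaves the extra term
      with factor m+1.\<close>
    have "of_nat (Suc m) * (strip i ^^ m) b
        = shuffle_letter j ((strip i ^^ Suc m) a) - shuffle_letter i (shuffle_letter j u)"
      using strip_funpow_shuffle_letter[of m i b] strip_funpow_shuffle_letter_other[of i j "Suc m" a] assms(2,3)
      by (simp add: u[simplified] eq_diff_eq add.commute)
    also have "\<dots> = shuffle_letter j ((strip i ^^ Suc m) a - shuffle_letter i u)"
      by (simp add: shuffle_letter_commute[of i j] scalar_linear_diff)
    finally have "(strip i ^^ m) b = shuffle_letter j (scalar c * ((strip i ^^ Suc m) a - shuffle_letter i u))"
      by (metis c scalar_linear_scalar scalar_linear_shuffle_letter)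
    then show ?thesis by blast
  qed
  have "\<exists>u. (strip i ^^ M) b = shuffle_letter j u"
    unfolding M by (rule exI[of _ 0]) (simp add: scalar_linear_zero)
  from down_to_zero[of "\<lambda>m. \<exists>u. (strip i ^^ m) b = shuffle_letter j u", OF this step]
  show ?thesis by simp
qed

text \<open>\<open>strip k\<close> turns the condition on commutators into one on shuffles.
  Exactness for two distinct indices yields a primitive \<open>v\<close>, and injectivity shows that
  it serves every index; the primitives for the various k become the parts of \<open>u\<close> with
  first letter k.\<close>

lemma ad_l_cocycle_trivial:
  fixes f :: "'n::finite \<Rightarrow> ('n, 'l::comm_ring_1) free"
  assumes inv: "nat_invertible TYPE('l)" and "CARD('n) \<ge> 2"
    and const: "\<And>i. const_coeff (f i) = 0"
    and cocycle: "\<And>i j. ad_l j (f i) = ad_l i (f j)"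
  obtains u where "const_coeff u = 0" "\<And>i. f i = ad_l i u"
proof -
  obtain i0 j0 :: 'n where ij: "i0 \<noteq> j0"
    using assms(2) card_le_Suc0_iff_eq[of "UNIV :: 'n set"] by auto
  have strip_cocycle: "shuffle_letter j (strip k (f i)) = shuffle_letter i (strip k (f j))" for i j k
    by (simp add: cocycle[of j i] flip: strip_ad_l)
  have "\<exists>v. \<forall>i. strip k (f i) = shuffle_letter i v" for k
  proof -
    obtain v where v: "strip k (f j0) = shuffle_letter j0 v"
      using shuffle_letter_exact[OF inv ij strip_cocycle] by blast
    have "strip k (f i) = shuffle_letter i v" for i
      by (rule shuffle_letter_cancel[OF inv, of j0])
        (simp add: strip_cocycle[of j0 k i] v shuffle_letter_commute[of i j0])
    then show ?thesis by blast
  qed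
  then obtain v where v: "\<And>k i. strip k (f i) = shuffle_letter i (v k)" by metis
  define u where "u = (\<Sum>k\<in>UNIV. letter k * v k)"
  have "f i = ad_l i u" for i
    by (subst free_decompose) (simp add: const v u_def scalar_linear_sum ad_l_letter_mult)
  moreover have "const_coeff u = 0"
    by (simp add: u_def scalar_linear_sum)
  ultimately show ?thesis using that by blast
qed

text \<open>On a word \<open>w\<close>, \<open>insert_inner j\<close> inserts \<open>j\<close> at all positions except the last one.\<close>

definition insert_inner :: "'n \<Rightarrow> ('n, 'l::comm_ring_1) free \<Rightarrow> ('n, 'l) free" where
  "insert_inner j x = shuffle_letter j x - x * letter j"

lemma scalar_linear_insert_inner [simp]: "scalar_linear (insert_inner j)"
  by (simp add: scalar_linear_def insert_inner_def linear_simps algebra_simps mult_scalar_assoc)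

text \<open>Right multiplication by a letter reaches the front only at a constant, so the Weyl
  relation survives up to the constant term.\<close>

lemma strip_insert_inner:
  "strip i (insert_inner j x) = insert_inner j (strip i x) + (if i = j then x - const_coeff x else 0)"
  by (simp add: insert_inner_def scalar_linear_diff strip_shuffle_letter strip_mult strip_letter)

lemma const_coeff_insert_inner [simp]: "const_coeff (insert_inner j x) = 0"
  by (simp add: insert_inner_def shuffle_letter_def scalar_linear_diff scalar_linear_add const_coeff_mult)

lemma const_coeff_idem [simp]: "const_coeff (const_coeff x) = const_coeff x"
  by (simp add: const_coeff_eq_scalar[of x])

lemma insert_inner_const_coeff [simp]: "insert_inner j (const_coeff x) = 0"
  using scalar_linear_scalar[OF scalar_linear_ad_l, of j _ 1]
  by (simp add: const_coeff_eq_scalar insert_inner_def shuffle_letter_def mult_scalar)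

text \<open>The descent used for \<open>shuffle_letter\<close>, now modulo constants.\<close>

lemma insert_inner_eq_0:
  fixes x :: "('n, 'l::comm_ring_1) free"
  assumes inv: "nat_invertible TYPE('l)" and "insert_inner j x = 0"
  shows "x = const_coeff x"
proof -
  let ?e = "\<lambda>m. (strip j ^^ m) x"
  \<comment> \<open>Each further strip kills the constant subtracted before, so a single correction
    remains for every m.\<close>
  have comm: "(strip j ^^ Suc m) (insert_inner j x) =
    insert_inner j (?e (Suc m)) + of_nat (Suc m) * ?e m - const_coeff (?e m)" for m
  proof (induction m)
    case (Suc m)
    have "(strip j ^^ Suc (Suc m)) (insert_inner j x) = strip j ((strip j ^^ Suc m) (insert_inner j x))"
      by simp
    also have "\<dots> = strip j (insert_inner j (?e (Suc m))) + of_nat (Suc m) * ?e (Suc m)"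
      unfolding Suc by (simp add: scalar_linear_add scalar_linear_diff scalar_linear_of_nat[OF scalar_linear_strip]
       del: of_nat_Suc)
    finally show ?case
      by (simp add: strip_insert_inner algebra_simps)
  qed (simp add: strip_insert_inner)
  obtain M where M: "?e M = 0" by (rule exE[OF strip_nilpotent])
  have zero: "(strip j ^^ m) (0 :: ('n, 'l) free) = 0" for m
    by (induction m) (simp_all add: scalar_linear_zero)
  have step: "?e m = const_coeff (?e m)" if "?e (Suc m) = const_coeff (?e (Suc m))" for m
  proof -
    obtain c :: 'l where c: "\<And>x :: ('n, 'l) free. scalar c * (of_nat (Suc m) * x) = x"
      using nat_invertibleE[OF assms(1)] by blast
    have "insert_inner j (?e (Suc m)) = 0"
      by (subst that) simp
    then have "of_nat (Suc m) * ?e m = const_coeff (?e m)"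
      using comm[of m] zero[of "Suc m"] assms(2) by simp
    then have eq: "?e m = scalar c * const_coeff (?e m)"
      using c[of "?e m"] by simp
    then have "const_coeff (?e m) = scalar c * const_coeff (?e m)"
      by (metis const_coeff_idem scalar_linear_const_coeff scalar_linear_scalar)
    with eq show ?thesis by simp
  qed
  show ?thesis
    using down_to_zero[of "\<lambda>m. ?e m = const_coeff (?e m)" M, OF _ step] M
    by (simp add: scalar_linear_zero)
qed

text \<open>The hypothesis \<open>eq\<close> says that the derivation r_i \<mapsto>
  \<open>g i\<close> of the free algebra commutes with every \<open>ad_l j\<close>; the conclusions
  on \<open>h\<close> say that it is a linear form in the letters. Stripping first letters gives
  equations for \<open>insert_inner\<close>, whose kernel consists of constants.\<close>

lemma ad_l_commuting_derivation:
  fixes g :: "'n::finite \<Rightarrow> ('n, 'l::comm_ring_1) free"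
  assumes inv: "nat_invertible TYPE('l)"
    and const: "\<And>i. const_coeff (g i) = 0"
    and eq: "\<And>i j. ad_l j (g i) = g i * letter j + letter i * g j"
  obtains h where "\<And>i. g i = letter i * h" "const_coeff h = 0"
    "\<And>k. strip k h = const_coeff (strip k h)"
proof -
  have ins: "insert_inner j (strip k (g i)) = (if k = i then g j else 0)" for i j k
  proof -
    have "shuffle_letter j (strip k (g i)) = strip k (ad_l j (g i))"
      by (simp add: strip_ad_l)
    also have "\<dots> = strip k (g i) * letter j + (if k = i then g j else 0)"
      by (simp add: eq scalar_linear_add strip_mult[of _ "g i"] const strip_letter_mult)
    finally show ?thesis by (simp add: insert_inner_def)
  qed
  define h where "h i = strip i (g i)" for i
  have insh: "insert_inner j (h i) = g j" for i j
    by (simp add: h_def ins)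
  have off: "strip k (g i) = 0" and strip_off: "strip k (h i) = const_coeff (strip k (h i))" if "k \<noteq> i" for i k
  proof -
    have "strip k (g i) = const_coeff (strip k (g i))"
      by (rule insert_inner_eq_0[OF inv, of i]) (simp add: ins that)
    \<comment> \<open>\<open>g i\<close> is \<open>insert_inner i (h i)\<close>, and
      \<open>insert_inner i\<close> commutes with \<open>strip k\<close> for k \<noteq> i. Hence
      \<open>strip k (g i)\<close>, already known to be constant, has constant term 0.\<close>
    moreover have s: "strip k (g i) = insert_inner i (strip k (h i))"
      using strip_insert_inner[of k i "h i"] that by (simp add: insh)
    ultimately show "strip k (g i) = 0" by (metis const_coeff_insert_inner)
    with s show "strip k (h i) = const_coeff (strip k (h i))"
      by (intro insert_inner_eq_0[OF inv, of i]) simp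
  qed
  have diag: "insert_inner i (strip i (h i)) = const_coeff (h i)" for i
  proof -
    \<comment> \<open>Stripping i from \<open>g i = insert_inner i (h i)\<close> returns
      \<open>h i\<close> by definition, so all but the constant term cancels.\<close>
    have "h i = insert_inner i (strip i (h i)) + (h i - const_coeff (h i))"
      using strip_insert_inner[of i i "h i"] by (simp add: insh h_def[symmetric])
    then show ?thesis by (simp add: algebra_simps)
  qed
  have h0: "const_coeff (h i) = 0" for i
    using arg_cong[OF diag, of const_coeff i] by simp
  have strip_h: "strip k (h i) = const_coeff (strip k (h i))" for i k
    using strip_off[of k i] insert_inner_eq_0[OF inv, of i "strip i (h i)"] diag[of i] h0[of i] by metis
  have g: "g i = letter i * h i" for i
    by (rule strip_eqI) (simp_all add: const strip_letter_mult off h_def)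
  have "h i = h j" for i j
  proof -
    have "h j = strip j (insert_inner j (h i))"
      unfolding insh by (rule h_def)
    also have "\<dots> = insert_inner j (strip j (h i)) + h i"
      by (simp add: strip_insert_inner h0)
    also have "insert_inner j (strip j (h i)) = 0"
      by (subst strip_h) simp
    finally show ?thesis by simp
  qed
  \<comment> \<open>All \<open>h i\<close> agree, so an arbitrary index serves.\<close>
  then have "g i = letter i * h undefined" for i
    using g by metis
  with that h0 strip_h show ?thesis by blast
qed

section \<open>Normal form coordinates on \<open>U\<^sub>n\<close>\<close>

text \<open>A monomial in commuting variables is the multiset of its indices.\<close>

type_synonym ('k, 'n) lpoly = "'n multiset \<Rightarrow>\<^sub>0 'k"

definition lconst :: "'k::field \<Rightarrow> ('k, 'n) lpoly" where
  "lconst c = Poly_Mapping.single 0 c"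

definition lvar :: "'n \<Rightarrow> ('k::field, 'n) lpoly" where
  "lvar i = Poly_Mapping.single {#i#} 1"

lemma lconst_add: "lconst (a + b) = lconst a + lconst b"
  and lconst_mult: "lconst (a * b) = lconst a * lconst b"
  and lconst_zero [simp]: "lconst 0 = 0"
  and lconst_one [simp]: "lconst 1 = 1"
  by (simp_all add: lconst_def single_add mult_single)

text \<open>The right regular representation of \<open>U\<^sub>n\<close> in the basis of the products of a monomial in the
  \<open>l\<^sub>i\<close> with a word in the \<open>r\<^sub>i\<close>.\<close>

primrec act_gen :: "('n, ('k::field, 'n) lpoly) free \<Rightarrow> 'n gen \<Rightarrow> ('n, ('k, 'n) lpoly) free" where
  "act_gen v (GenL j) = scalar (lvar j) * v + ad_l j v"
| "act_gen v (GenR j) = v * letter j"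

definition act ::
  "('n, ('k::field, 'n) lpoly) free \<Rightarrow> ('n gen word \<Rightarrow>\<^sub>0 'k) \<Rightarrow> ('n, ('k, 'n) lpoly) free" where
  "act v = extend (\<lambda>w c. scalar (lconst c) * foldl act_gen v (letters w))"

lemma scalar_linear_act_gen: "scalar_linear (\<lambda>v. act_gen v g)"
  by (cases g) (simp_all add: scalar_linear_def linear_simps algebra_simps scalar_left_commute)

lemma scalar_linear_foldl_act_gen: "scalar_linear (\<lambda>v. foldl act_gen v gs)"
proof (induction gs)
  case (Cons g gs)
  then show ?case
    by (simp add: scalar_linear_def scalar_linear_add[OF scalar_linear_act_gen]
      scalar_linear_scalar[OF scalar_linear_act_gen])
qed (simp add: scalar_linear_def)

lemma act_single: "act v (Poly_Mapping.single w c) = scalar (lconst c) * foldl act_gen v (letters w)"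
  unfolding act_def by (rule extend_single) simp

lemma act_add: "act v (x + y) = act v x + act v y"
  unfolding act_def by (rule extend_add) (simp_all add: lconst_add scalar_add distrib_right)

lemma scalar_linear_act: "scalar_linear (\<lambda>v. act v x)"
proof (induction x rule: free_algebra_induct)
  case (single w c)
  then show ?case
    by (simp add: scalar_linear_def act_single distrib_left scalar_left_commute
      scalar_linear_add[OF scalar_linear_foldl_act_gen] scalar_linear_scalar[OF scalar_linear_foldl_act_gen])
next
  case (add x y)
  then show ?case by (simp add: scalar_linear_def act_add algebra_simps)
qed

lemma act_mult: "act v (x * y) = act (act v x) y"
proof (induction x rule: free_algebra_induct)
  case (single u c)
  show ?case
  proof (induction y rule: free_algebra_induct)
    case (single w d)
    show ?case
      by (simp add: mult_single act_single plus_word_def lconst_mult scalar_mult mult.assoc scalar_left_commute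
        scalar_linear_scalar[OF scalar_linear_foldl_act_gen])
  qed (simp add: distrib_left act_add)
qed (simp add: distrib_right act_add scalar_linear_add[OF scalar_linear_act])

lemma act_one: "act v 1 = v"
  using act_single[of v "Word []" 1] by (simp add: monomial_Nil)

lemma act_free_gen: "act v (free_gen g) = act_gen v g"
  by (simp add: free_gen_def act_single)

lemma act_zero: "act v 0 = 0"
  by (simp add: act_def)

lemma act_diff: "act v (x - y) = act v x - act v y"
  using act_add[of v "x - y" y] by simp

lemma act_ideal_relators:
  fixes x :: "'n gen word \<Rightarrow>\<^sub>0 'k::field"
  assumes "x \<in> ideal_generated relators"
  shows "act v x = 0"
proof -
  \<comment> \<open>Annihilating every \<open>v\<close>, not only one, is what makes this set closed
    under multiplication from the left.\<close>
  let ?J = "{x :: 'n gen word \<Rightarrow>\<^sub>0 'k. \<forall>v. act v x = 0}"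
  have "two_sided_ideal ?J"
    by (simp add: two_sided_ideal_def act_zero act_add act_mult scalar_linear_zero[OF scalar_linear_act])
  moreover have "relators \<subseteq> ?J"
  proof -
    have "act v (free_gen (GenL i) * free_gen (GenL j) - free_gen (GenL j) * free_gen (GenL i)) = 0"
      for v :: "('n, ('k, 'n) lpoly) free" and i j
      by (simp add: act_diff act_mult act_free_gen distrib_left scalar_left_commute[of "lvar i"]
          ad_l_commute[of i j] linear_simps)
    moreover have "act v (free_gen (GenR i) * free_gen (GenL j)
        - (free_gen (GenL j) * free_gen (GenR i) + free_gen (GenR i) * free_gen (GenR j))) = 0"
      for v :: "('n, ('k, 'n) lpoly) free" and i j
      by (simp add: act_diff act_add act_mult act_free_gen ad_l_mult ad_l_letter algebra_simps)
    ultimately show ?thesis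
      unfolding relators_def by blast
  qed
  ultimately have "ideal_generated relators \<subseteq> ?J"
    unfolding ideal_generated_def by blast
  with assms show ?thesis by blast
qed

lift_definition U_act ::
  "('n, ('k::field, 'n) lpoly) free \<Rightarrow> ('k, 'n) U \<Rightarrow> ('n, ('k, 'n) lpoly) free"
  is act
  unfolding U_rel_def using act_ideal_relators act_diff by (metis right_minus_eq)

lemma U_act_add: "U_act v (x + y) = U_act v x + U_act v y"
  by (induction x rule: U.abs_induct, induction y rule: U.abs_induct)
    (simp add: U_act.abs_eq plus_U.abs_eq act_add)

lemma U_act_mult: "U_act v (x * y) = U_act (U_act v x) y"
  by (induction x rule: U.abs_induct, induction y rule: U.abs_induct)
    (simp add: U_act.abs_eq times_U.abs_eq act_mult)

lemma U_act_one [simp]: "U_act v 1 = v"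
  by (simp add: one_U_def U_act.abs_eq act_one)

lemma scalar_linear_U_act: "scalar_linear (\<lambda>v. U_act v x)"
  by (induction x rule: U.abs_induct) (simp add: U_act.abs_eq scalar_linear_act)

lemma U_act_U_l [simp]: "U_act v (U_l j) = scalar (lvar j) * v + ad_l j v"
  by (simp add: U_l_def U_act.abs_eq act_free_gen)

lemma U_act_U_r [simp]: "U_act v (U_r j) = v * letter j"
  by (simp add: U_r_def U_act.abs_eq act_free_gen)

lemma U_act_scale: "U_act v (U_scale c x) = scalar (lconst c) * U_act v x"
proof (induction x rule: U.abs_induct)
  case (1 x)
  have "act v (Poly_Mapping.single 0 c) = scalar (lconst c) * v"
    by (simp add: act_single zero_word_def)
  then show ?case
    by (simp add: U_scale.abs_eq U_act.abs_eq act_mult scalar_linear_scalar[OF scalar_linear_act])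
qed

definition coords :: "('k::field, 'n) U \<Rightarrow> ('n, ('k, 'n) lpoly) free" where
  "coords x = U_act 1 x"

lemma U_induct [case_names one l r scale add mult]:
  assumes one: "P 1" and l: "\<And>i. P (U_l i)" and r: "\<And>i. P (U_r i)"
    and scale: "\<And>c x. P x \<Longrightarrow> P (U_scale c x)"
    and add: "\<And>x y. P x \<Longrightarrow> P y \<Longrightarrow> P (x + y)"
    and mult: "\<And>x y. P x \<Longrightarrow> P y \<Longrightarrow> P (x * y)"
  shows "P (x :: ('k::field, 'n) U)"
proof -
  have word: "P (abs_U (Poly_Mapping.single (Word gs) 1))" for gs :: "'n gen list"
  proof (induction gs)
    case Nil
    have "abs_U (Poly_Mapping.single (Word []) 1) = (1 :: ('k, 'n) U)"
      by (simp add: one_U_def flip: zero_word_def)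
    then show ?case using one by simp
  next
    case (Cons g gs)
    have "P (abs_U (free_gen g))"
      using l r by (cases g) (simp_all add: U_l_def U_r_def)
    moreover have "abs_U (Poly_Mapping.single (Word (g # gs)) 1) =
        abs_U (free_gen g) * abs_U (Poly_Mapping.single (Word gs) (1::'k))"
      by (simp add: times_U.abs_eq free_gen_def mult_single plus_word_def)
    ultimately show ?case using mult Cons by simp
  qed
  have "P (abs_U y)" for y :: "'n gen word \<Rightarrow>\<^sub>0 'k"
  proof (induction y rule: free_algebra_induct)
    case (single w c)
    have "abs_U (Poly_Mapping.single w c) = U_scale c (abs_U (Poly_Mapping.single (Word (letters w)) 1))"
      by (simp add: U_scale.abs_eq mult_single)
    then show ?case using scale[OF word[of "letters w"]] by metis
  qed (simp add: add flip: plus_U.abs_eq)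
  then show ?thesis by (rule U.abs_induct)
qed

section \<open>Assembling elements of \<open>U\<close> from coordinates\<close>

definition l_monomial :: "'n multiset \<Rightarrow> ('k::field, 'n) U" where
  "l_monomial a = fold_mset (\<lambda>i. (*) (U_l i)) 1 a"

lemma l_monomial_empty [simp]: "l_monomial {#} = 1"
  by (simp add: l_monomial_def)

lemma l_monomial_add_mset [simp]: "l_monomial (add_mset i a) = U_l i * l_monomial a"
proof -
  interpret comp_fun_commute "\<lambda>i. (*) (U_l i :: ('a, 'b) U)"
    by standard (simp add: fun_eq_iff U_l_commute flip: mult.assoc)
  show ?thesis by (simp add: l_monomial_def)
qed

lemma l_monomial_union: "l_monomial (a + b) = l_monomial a * l_monomial b"
  by (induction a) (simp_all add: mult.assoc)

definition l_eval :: "('k::field, 'n) lpoly \<Rightarrow> ('k, 'n) U" where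
  "l_eval = extend (\<lambda>a c. U_scale c (l_monomial a))"

lemma l_eval_single: "l_eval (Poly_Mapping.single a c) = U_scale c (l_monomial a)"
  unfolding l_eval_def by (rule extend_single) simp

lemma l_eval_add: "l_eval (p + q) = l_eval p + l_eval q"
  unfolding l_eval_def by (rule extend_add) (simp_all add: U.scale_left_distrib)

lemma l_eval_zero [simp]: "l_eval 0 = 0"
  by (simp add: l_eval_def)

lemma l_eval_mult: "l_eval (p * q) = l_eval p * l_eval q"
proof (induction p rule: free_algebra_induct)
  case (single a c)
  show ?case
  proof (induction q rule: free_algebra_induct)
    case (single b d)
    show ?case
      by (simp add: mult_single l_eval_single l_monomial_union
        flip: U_scale_mult_left U_scale_mult_right)
  qed (simp add: distrib_left l_eval_add)
qed (simp add: distrib_right l_eval_add)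

lemma l_eval_one [simp]: "l_eval 1 = 1"
  using l_eval_single[of 0 1] by simp

lemma l_eval_lvar [simp]: "l_eval (lvar i) = U_l i"
  by (simp add: lvar_def l_eval_single)

definition r_word :: "'n list \<Rightarrow> ('k::field, 'n) U" where
  "r_word w = prod_list (map U_r w)"

definition assemble :: "('n, ('k::field, 'n) lpoly) free \<Rightarrow> ('k, 'n) U" where
  "assemble = extend (\<lambda>w p. l_eval p * r_word (letters w))"

lemma assemble_single: "assemble (Poly_Mapping.single w p) = l_eval p * r_word (letters w)"
  unfolding assemble_def by (rule extend_single) simp

lemma assemble_monomial: "assemble (scalar p * monomial w) = l_eval p * r_word w"
  by (simp add: assemble_single flip: single_Word)

lemma assemble_word: "assemble (monomial w) = r_word w"
  using assemble_monomial[of 1 w] by simp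

lemma assemble_add: "assemble (x + y) = assemble x + assemble y"
  unfolding assemble_def by (rule extend_add) (simp_all add: l_eval_add distrib_right)

lemma assemble_scalar: "assemble (scalar p * x) = l_eval p * assemble x"
proof (induction x rule: free_induct)
  case (monomial w q)
  have "scalar p * (scalar q * monomial w) = scalar (p * q) * monomial w"
    by (simp add: scalar_mult mult.assoc)
  then show ?case by (simp add: assemble_monomial l_eval_mult mult.assoc)
qed (simp add: distrib_left assemble_add)

lemma assemble_one [simp]: "assemble 1 = 1"
  using assemble_monomial[of 1 "[]"] by (simp add: monomial_Nil r_word_def)

lemma assemble_mult_letter: "assemble (x * letter i) = assemble x * U_r i"
proof (induction x rule: free_induct)
  case (monomial w q)
  have "scalar q * monomial w * letter i = scalar q * monomial (w @ [i])"
    by (simp add: monomial_append mult.assoc monomial_Cons monomial_Nil)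
  then show ?case by (simp add: assemble_monomial r_word_def mult.assoc)
qed (simp add: distrib_right assemble_add)

lemma assemble_ad_l: "assemble (ad_l j x) = assemble x * U_l j - U_l j * assemble x"
  for x :: "('n, ('k::field, 'n) lpoly) free"
proof (induction x rule: free_induct)
  case (monomial w q)
  have word: "assemble (ad_l j (monomial w :: ('n, ('k, 'n) lpoly) free)) = r_word w * U_l j - U_l j * r_word w"
    for w :: "'n list"
  \<comment> \<open>Words grow at the right end, where \<open>assemble\<close> is multiplicative and
    the defining relation moves l_j past one letter.\<close>
  proof (induction w rule: rev_induct)
    case Nil
    show ?case by (simp add: monomial_Nil r_word_def assemble_def)
  next
    case (snoc i w)
    have "(monomial (w @ [i]) :: ('n, ('k, 'n) lpoly) free) = monomial w * letter i"
      by (simp add: monomial_append monomial_Cons monomial_Nil)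
    then have "assemble (ad_l j (monomial (w @ [i]) :: ('n, ('k, 'n) lpoly) free)) =
        (r_word w * U_l j - U_l j * r_word w) * U_r i + r_word w * U_r i * U_r j"
      using snoc
      by (simp add: ad_l_mult ad_l_letter assemble_word assemble_add assemble_mult_letter flip: mult.assoc)
    also have "\<dots> = r_word w * (U_r i * U_l j) - U_l j * r_word w * U_r i"
      by (simp add: U_r_U_l algebra_simps)
    finally show ?case by (simp add: r_word_def mult.assoc)
  qed
  have "l_eval q * U_l j = U_l j * l_eval q"
    by (simp add: mult.commute flip: l_eval_lvar l_eval_mult)
  then show ?case
    by (simp add: linear_simps assemble_scalar assemble_monomial assemble_word word right_diff_distrib
      flip: mult.assoc)
next
  case (add x y)
  then show ?case by (simp add: linear_simps assemble_add algebra_simps)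
qed

text \<open>Both sides respect sums, scalars and products in \<open>x\<close>, so generators
  suffice. At \<open>v = 1\<close> this makes \<open>assemble\<close> a left inverse of
  \<open>coords\<close>.\<close>

lemma assemble_U_act: "assemble (U_act v x) = assemble v * x"
  for x :: "('k::field, 'n) U"
proof (induction x arbitrary: v rule: U_induct)
  case (scale c x)
  have "l_eval (lconst c) = (U_scale c 1 :: ('k, 'n) U)"
    by (simp add: lconst_def l_eval_single)
  with scale show ?case
    by (simp add: U_act_scale assemble_scalar flip: U_scale_mult_left U_scale_mult_right)
qed (simp_all add: assemble_add assemble_scalar assemble_ad_l assemble_mult_letter U_act_add U_act_mult
    distrib_left mult.assoc)

lemma assemble_coords: "assemble (coords x) = x"
  by (simp add: coords_def assemble_U_act)

section \<open>Uniqueness of normal forms\<close>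

lemma U_act_r_word: "U_act v (r_word w) = v * monomial w"
  by (induction w arbitrary: v)
    (simp_all add: r_word_def U_act_mult monomial_Nil monomial_Cons mult.assoc)

lemma coords_l_monomial_mult: "coords (l_monomial a * y) = scalar (Poly_Mapping.single a 1) * coords y"
  for y :: "('k::field, 'n) U"
proof (induction a)
  case (add i a)
  have "coords (U_l i * z) = scalar (lvar i) * coords z" for z :: "('k, 'n) U"
    using scalar_linear_scalar[OF scalar_linear_U_act, of "lvar i" 1]
    by (simp add: coords_def U_act_mult)
  moreover have "lvar i * Poly_Mapping.single a (1::'k) = Poly_Mapping.single (add_mset i a) 1"
    by (simp add: lvar_def mult_single)
  ultimately show ?case
    by (simp add: mult.assoc add) (metis mult.assoc scalar_mult)
qed simp

lemma coords_add: "coords (x + y) = coords x + coords y"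
  by (simp add: coords_def U_act_add)

lemma coords_scale: "coords (U_scale c x) = scalar (lconst c) * coords x"
  by (simp add: coords_def U_act_scale)

lemma coords_l_eval_mult: "coords (l_eval p * y) = scalar p * coords y"
proof (induction p rule: free_algebra_induct)
  case (single a c)
  have "lconst c * Poly_Mapping.single a 1 = Poly_Mapping.single a c"
    by (simp add: lconst_def mult_single)
  then show ?case
    by (simp add: l_eval_single coords_scale coords_l_monomial_mult flip: U_scale_mult_left)
      (metis mult.assoc scalar_mult)
next
  case (add p q)
  then show ?case by (simp add: l_eval_add distrib_right scalar_add coords_add)
qed

text \<open>Together with \<open>assemble_coords\<close> this is the normal form theorem: the
  products of a monomial in the l_i with a word in the r_i form a basis.\<close>

lemma coords_assemble: "coords (assemble v) = v"
proof (induction v rule: free_induct)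
  case (monomial w p)
  show ?case by (simp add: assemble_monomial coords_l_eval_mult) (simp add: coords_def U_act_r_word)
qed (simp add: assemble_add coords_add)

section \<open>Filtration by word length\<close>

text \<open>Only word length counts; the coefficients, later polynomials in the l_i, have degree 0.
  Leading terms are those of least length.\<close>

definition low :: "nat \<Rightarrow> ('n, 'l::comm_ring_1) free set" where
  "low a = {v. \<forall>w\<in>Poly_Mapping.keys v. a \<le> length (letters w)}"

lemma low_lookup: "v \<in> low a \<Longrightarrow> length w < a \<Longrightarrow> Poly_Mapping.lookup v (Word w) = 0"
  by (force simp: low_def in_keys_iff)

lemma lowI: "(\<And>w. length w < a \<Longrightarrow> Poly_Mapping.lookup v (Word w) = 0) \<Longrightarrow> v \<in> low a"
proof -
  assume zero: "\<And>w. length w < a \<Longrightarrow> Poly_Mapping.lookup v (Word w) = 0"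
  have "a \<le> length (letters w)" if "w \<in> Poly_Mapping.keys v" for w
    using zero[of "letters w"] that by (auto simp: in_keys_iff not_le[symmetric])
  then show ?thesis by (simp add: low_def)
qed

lemma low_zero [simp]: "0 \<in> low a"
  by (simp add: low_def)

lemma low_0_UNIV [simp]: "v \<in> low 0"
  by (simp add: low_def)

lemma low_add: "x \<in> low a \<Longrightarrow> y \<in> low a \<Longrightarrow> x + y \<in> low a"
  by (rule lowI) (simp add: lookup_add low_lookup)

lemma low_diff: "x \<in> low a \<Longrightarrow> y \<in> low a \<Longrightarrow> x - y \<in> low a"
  by (rule lowI) (simp add: lookup_minus low_lookup)

lemma low_mono: "x \<in> low a \<Longrightarrow> b \<le> a \<Longrightarrow> x \<in> low b"
  by (force simp: low_def)

lemma lookup_scalar_mult: "Poly_Mapping.lookup (scalar p * x) w = p * Poly_Mapping.lookup x w"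
  by (induction x rule: free_algebra_induct)
    (simp_all add: scalar_def mult_single lookup_single when_def distrib_left lookup_add)

lemma low_scalar: "x \<in> low a \<Longrightarrow> scalar p * x \<in> low a"
  by (rule lowI) (simp add: lookup_scalar_mult low_lookup)

text \<open>Summing over the support of \<open>x\<close> alone keeps all words that occur at length
  at least \<open>a\<close>.\<close>

lemma low_induct [consumes 1, case_names zero monomial add]:
  assumes "x \<in> low a" "P 0"
    and "\<And>w p. a \<le> length w \<Longrightarrow> P (scalar p * monomial w)"
    and "\<And>x y. P x \<Longrightarrow> P y \<Longrightarrow> P (x + y)"
  shows "P (x :: ('n, 'l::comm_ring_1) free)"
proof -
  have "P (\<Sum>w\<in>A. Poly_Mapping.single w (Poly_Mapping.lookup x w))"
    if "finite A" "A \<subseteq> Poly_Mapping.keys x" for A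
    using that
  proof (induction A)
    case (insert w A)
    have "P (Poly_Mapping.single w (Poly_Mapping.lookup x w))"
      using assms(3)[of "letters w" "Poly_Mapping.lookup x w"] assms(1) insert.prems
        single_Word[of "letters w" "Poly_Mapping.lookup x w"] by (simp add: low_def)
    then show ?case using insert assms(4) by simp
  qed (simp add: assms(2))
  moreover have "(\<Sum>w\<in>Poly_Mapping.keys x. Poly_Mapping.single w (Poly_Mapping.lookup x w)) = x"
    by (rule poly_mapping_eqI) (simp add: lookup_sum lookup_single when_def in_keys_iff)
  ultimately show ?thesis
    by (metis finite_keys order_refl)
qed

lemma low_monomial: "a \<le> length w \<Longrightarrow> scalar p * monomial w \<in> low a"
  by (rule lowI) (auto simp: lookup_single when_def simp flip: single_Word)

lemma monomial_mult_monomial: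
  "scalar p * monomial w * (scalar q * monomial v) = scalar (p * q) * monomial (w @ v)"
  by (simp add: scalar_def mult_single plus_word_def zero_word_def)

lemma low_mult:
  assumes "x \<in> low a" "y \<in> low b"
  shows "x * y \<in> low (a + b)"
  using assms(1)
proof (induction rule: low_induct)
  case (monomial w p)
  from assms(2) show ?case
  proof (induction rule: low_induct)
    case (monomial v q)
    with \<open>a \<le> length w\<close> show ?case
      by (simp only: monomial_mult_monomial) (rule low_monomial, simp)
  qed (simp_all add: distrib_left low_add)
qed (simp_all add: distrib_right low_add)

text \<open>In lowest degree the lengths of both factors are forced, so a word splits in only one
  way.\<close>

lemma lookup_mult_append:
  assumes "x \<in> low (length w)" "y \<in> low (length v)"
  shows "Poly_Mapping.lookup (x * y) (Word (w @ v)) =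
    Poly_Mapping.lookup x (Word w) * Poly_Mapping.lookup y (Word v)"
  using assms(1)
proof (induction rule: low_induct)
  case (monomial w' p)
  from assms(2) show ?case
  proof (induction rule: low_induct)
    case (monomial v' q)
    have "w' @ v' = w @ v \<longleftrightarrow> w' = w \<and> v' = v"
    proof
      assume eq: "w' @ v' = w @ v"
      from arg_cong[OF this, of length] have "length w' = length w"
        using monomial \<open>length w \<le> length w'\<close> by simp
      with eq show "w' = w \<and> v' = v" by simp
    qed simp
    then show ?case
      unfolding monomial_mult_monomial by (auto simp: lookup_single when_def simp flip: single_Word)
  qed (simp_all add: distrib_left lookup_add)
qed (simp_all add: distrib_right lookup_add)

lemma low_letter: "letter i \<in> low 1"
  by (rule lowI) (simp add: letter_def lookup_single)

lemma lookup_letter: "Poly_Mapping.lookup (letter i) (Word [k]) = (if i = k then 1 else 0)"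
  by (simp add: letter_def lookup_single when_def)

lemma low_letter_mult: "x \<in> low a \<Longrightarrow> letter i * x \<in> low (Suc a)"
  using low_mult[OF low_letter] by fastforce

lemma lookup_letter_mult:
  "Poly_Mapping.lookup (letter i * x) (Word (k # w)) = (if i = k then Poly_Mapping.lookup x (Word w) else 0)"
proof (induction x rule: free_algebra_induct)
  case (single v p)
  then show ?case
    by (cases v) (auto simp: letter_def mult_single plus_word_def lookup_single when_def)
qed (simp add: distrib_left lookup_add)

lemma low_ad_l:
  fixes x :: "('n, 'l::comm_ring_1) free"
  assumes "x \<in> low a"
  shows "ad_l j x \<in> low (Suc a)"
  using assms
proof (induction rule: low_induct)
  case (monomial w p)
  have "(ad_l_word j w :: ('n, 'l) free) \<in> low (Suc (length w))"
  proof (induction w)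
    case (Cons i w)
    have "(letter j * monomial w :: ('n, 'l) free) \<in> low (Suc (length w))"
      using low_monomial[of "length w" w 1] by (intro low_letter_mult) simp
    with Cons show ?case by (simp add: low_letter_mult low_add)
  qed simp
  then have "ad_l j (monomial w :: ('n, 'l) free) \<in> low (Suc a)"
    using low_mono monomial by (metis ad_l_monomial Suc_le_mono)
  then show ?case by (simp add: linear_simps low_scalar)
qed (simp_all add: scalar_linear_zero linear_simps low_add)

section \<open>Homogeneous components\<close>

definition component :: "nat \<Rightarrow> ('n, 'l::comm_ring_1) free \<Rightarrow> ('n, 'l) free" where
  "component a = linear_extend (\<lambda>w. if length w = a then monomial w else 0)"

lemma scalar_linear_component [simp]: "scalar_linear (component a)"
  by (simp add: component_def)

lemmas [linear_simps] = scalar_linear_component[THEN scalar_linear_add]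
  scalar_linear_component[THEN scalar_linear_scalar]

lemma component_monomial: "component a (monomial w) = (if length w = a then monomial w else 0)"
  by (simp add: component_def)

lemma lookup_component:
  "Poly_Mapping.lookup (component a x) (Word w) =
    (if length w = a then Poly_Mapping.lookup x (Word w) else 0)"
  by (induction x rule: free_induct)
    (auto simp: linear_simps lookup_add lookup_scalar_mult component_monomial lookup_single when_def)

lemma component_low: "x \<in> low (Suc a) \<Longrightarrow> component a x = 0"
  by (induction rule: low_induct) (simp_all add: linear_simps scalar_linear_zero component_monomial)

lemma low_Suc: "x \<in> low a \<Longrightarrow> component a x = 0 \<Longrightarrow> x \<in> low (Suc a)"
  by (rule lowI) (metis low_lookup lookup_component less_antisym lookup_zero)

lemma component_letter_mult: "component (Suc a) (letter i * x) = letter i * component a x"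
  for x :: "('n, 'l::comm_ring_1) free"
proof (induction x rule: free_induct)
  case (monomial w p)
  have "component (Suc a) (letter i * monomial w) = letter i * component a (monomial w :: ('n, 'l) free)"
    unfolding monomial_Cons[symmetric] component_monomial by (simp flip: monomial_Cons)
  then show ?case by (simp add: mult_scalar_assoc linear_simps)
qed (simp add: distrib_left linear_simps)

lemma component_0_letter_mult: "component 0 (letter i * x) = 0"
  using component_low[of "letter i * x" 0] low_letter_mult[of x 0 i] by simp

lemma component_mult_letter: "component (Suc a) (x * letter i) = component a x * letter i"
  for x :: "('n, 'l::comm_ring_1) free"
proof (induction x rule: free_induct)
  case (monomial w p)
  have "(monomial w * letter i :: ('n, 'l) free) = monomial (w @ [i])"
    by (simp add: monomial_append monomial_Cons monomial_Nil)
  then have "component (Suc a) (monomial w * letter i :: ('n, 'l) free) = component a (monomial w) * letter i"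
    by (simp add: component_monomial)
  then show ?case by (simp add: mult.assoc linear_simps)
qed (simp add: distrib_right linear_simps)

lemma component_ad_l: "component (Suc a) (ad_l j x) = ad_l j (component a x)"
  for x :: "('n, 'l::comm_ring_1) free"
proof (induction x rule: free_induct)
  case (monomial w p)
  have "component (Suc a) (ad_l j (monomial w :: ('n, 'l) free)) = ad_l j (component a (monomial w))"
  proof (induction w arbitrary: a)
    case Nil
    show ?case by (simp add: ad_l_monomial scalar_linear_zero component_monomial)
  next
    case (Cons i w)
    show ?case
    proof (cases a)
      case 0
      then show ?thesis
        by (simp add: monomial_Cons ad_l_letter_mult component_letter_mult shuffle_letter_def linear_simps
          component_0_letter_mult scalar_linear_zero)
          (metis component_low low_0_UNIV low_ad_l mult_zero_right)
    next
      case (Suc b)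
      then show ?thesis
        by (simp add: monomial_Cons ad_l_letter_mult component_letter_mult shuffle_letter_def linear_simps Cons)
    qed
  qed
  then show ?case by (simp add: linear_simps)
qed (simp add: linear_simps)

section \<open>The filtration of \<open>U\<^sub>n\<close>\<close>

definition coef :: "('k::field, 'n) U \<Rightarrow> 'n list \<Rightarrow> ('k, 'n) lpoly" where
  "coef x w = Poly_Mapping.lookup (coords x) (Word w)"

definition U_low :: "nat \<Rightarrow> ('k::field, 'n) U set" where
  "U_low a = {x. coords x \<in> low a}"

text \<open>Moving a polynomial in the l_j to the left of \<open>v\<close> costs only terms with
  \<open>ad_l\<close>, and these have longer words.\<close>

lemma U_act_l_eval_low:
  fixes v :: "('n, ('k::field, 'n) lpoly) free"
  assumes "v \<in> low a"
  shows "U_act v (l_eval p) - scalar p * v \<in> low (Suc a)"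
proof -
  have mono: "U_act v (l_monomial m) - scalar (Poly_Mapping.single m 1) * v \<in> low (Suc a)"
    if "v \<in> low a" for v :: "('n, ('k, 'n) lpoly) free" and m
    using that
  proof (induction m arbitrary: v)
    case (add i m)
    let ?v = "scalar (lvar i) * v + ad_l i v" and ?X = "scalar (Poly_Mapping.single m 1)"
    have ad: "ad_l i v \<in> low (Suc a)"
      by (rule low_ad_l) fact
    then have "?v \<in> low a"
      using add.prems by (intro low_add low_scalar) (auto elim: low_mono)
    then have "U_act ?v (l_monomial m) - ?X * ?v + ?X * ad_l i v \<in> low (Suc a)"
      using add.IH low_scalar[OF ad] by (intro low_add)
    moreover have "(scalar (Poly_Mapping.single (add_mset i m) 1) :: ('n, ('k, 'n) lpoly) free) =
        ?X * scalar (lvar i)"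
      by (simp add: lvar_def mult_single flip: scalar_mult)
    ultimately show ?case
      by (simp add: U_act_mult distrib_left mult.assoc diff_diff_eq)
  qed simp
  show ?thesis
  proof (induction p rule: free_algebra_induct)
    case (single m c)
    have "scalar (Poly_Mapping.single m c) =
        (scalar (lconst c) * scalar (Poly_Mapping.single m 1) :: ('n, ('k, 'n) lpoly) free)"
      by (simp add: lconst_def mult_single flip: scalar_mult)
    then have "U_act v (l_eval (Poly_Mapping.single m c)) - scalar (Poly_Mapping.single m c) * v
        = scalar (lconst c) * (U_act v (l_monomial m) - scalar (Poly_Mapping.single m 1) * v)"
      by (simp add: l_eval_single U_act_scale right_diff_distrib mult.assoc)
    then show ?case using mono[OF assms] by (simp add: low_scalar)
  next
    case (add p q)
    then have "(U_act v (l_eval p) - scalar p * v) + (U_act v (l_eval q) - scalar q * v) \<in> low (Suc a)"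
      by (rule low_add)
    then show ?case by (simp add: l_eval_add U_act_add scalar_add algebra_simps)
  qed
qed

lemma U_act_low:
  fixes y :: "('k::field, 'n) U"
  assumes "v \<in> low a" "y \<in> U_low b"
  shows "U_act v y - v * coords y \<in> low (Suc (a + b))"
proof -
  have "U_act v (assemble z) - v * z \<in> low (Suc (a + b))" if "z \<in> low b" for z
    using that
  proof (induction rule: low_induct)
    case zero
    have "assemble 0 = (0 :: ('k, 'n) U)" by (simp add: assemble_def)
    moreover have "U_act v 0 = 0" using U_act_add[of v 0 0] by simp
    ultimately show ?case by simp
  next
    case (monomial w p)
    have "U_act v (assemble (scalar p * monomial w)) - v * (scalar p * monomial w)
        = (U_act v (l_eval p) - scalar p * v) * (scalar 1 * monomial w)"
      by (simp add: assemble_monomial U_act_mult U_act_r_word left_diff_distrib mult_scalar_assoc mult.assoc)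
    also have "\<dots> \<in> low (Suc a + b)"
      using monomial by (intro low_mult U_act_l_eval_low assms(1) low_monomial)
    finally show ?case by simp
  next
    case (add x y)
    then have "(U_act v (assemble x) - v * x) + (U_act v (assemble y) - v * y) \<in> low (Suc (a + b))"
      by (rule low_add)
    then show ?case by (simp add: assemble_add U_act_add algebra_simps)
  qed
  from this[of "coords y"] assms(2) show ?thesis
    by (simp add: U_low_def assemble_coords)
qed

text \<open>Lowest terms thus multiply as in the free algebra over the polynomials in the l_i, where
  coefficients commute with letters.\<close>

lemma coords_mult_low:
  "x \<in> U_low a \<Longrightarrow> y \<in> U_low b \<Longrightarrow> coords (x * y) - coords x * coords y \<in> low (Suc (a + b))"
  using U_act_low[of "coords x" a y b] by (simp add: coords_def U_act_mult U_low_def)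

lemma U_low_mult:
  assumes "x \<in> U_low a" "y \<in> U_low b"
  shows "x * y \<in> U_low (a + b)"
proof -
  have "(coords (x * y) - coords x * coords y) + coords x * coords y \<in> low (a + b)"
    using coords_mult_low[OF assms] assms
    by (intro low_add low_mult) (auto simp: U_low_def elim: low_mono)
  then show ?thesis by (simp add: U_low_def)
qed

lemma coef_mult:
  assumes "x \<in> U_low (length w)" "y \<in> U_low (length v)"
  shows "coef (x * y) (w @ v) = coef x w * coef y v"
proof -
  have "Poly_Mapping.lookup (coords (x * y) - coords x * coords y) (Word (w @ v)) = 0"
    by (rule low_lookup[OF coords_mult_low[OF assms]]) simp
  then show ?thesis
    using assms lookup_mult_append[of "coords x" w "coords y" v]
    by (simp add: coef_def lookup_minus U_low_def)
qed

lemma coords_zero [simp]: "coords 0 = 0"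
  using coords_add[of 0 0] by simp

lemma coords_uminus: "coords (- x) = - coords x"
  using coords_add[of x "- x"] by (simp add: eq_neg_iff_add_eq_0 add.commute)

lemma coords_diff: "coords (x - y) = coords x - coords y"
  using coords_add[of x "- y"] by (simp add: coords_uminus)

lemma coords_inj: "coords x = coords y \<Longrightarrow> x = y"
  by (metis assemble_coords)

lemma coords_one [simp]: "coords 1 = 1"
  by (simp add: coords_def)

lemma coords_U_r [simp]: "coords (U_r i) = letter i"
  by (simp add: coords_def)

lemma coords_U_l_mult: "coords (U_l i * x) = scalar (lvar i) * coords x"
  using coords_l_eval_mult[of "lvar i" x] by simp

lemma coords_mult_U_l: "coords (x * U_l i) = scalar (lvar i) * coords x + ad_l i (coords x)"
  by (simp add: coords_def U_act_mult)

lemma coords_mult_U_r: "coords (x * U_r i) = coords x * letter i"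
  by (simp add: coords_def U_act_mult)

lemma coef_add: "coef (x + y) w = coef x w + coef y w"
  and coef_diff: "coef (x - y) w = coef x w - coef y w"
  by (simp_all add: coef_def coords_add coords_diff lookup_add lookup_minus)

lemma coef_U_r: "coef (U_r i) [k] = (if i = k then 1 else 0)"
  by (simp add: coef_def lookup_letter)

lemma U_low_0 [simp]: "x \<in> U_low 0"
  and U_low_zero [simp]: "0 \<in> U_low a"
  and U_low_add: "x \<in> U_low a \<Longrightarrow> y \<in> U_low a \<Longrightarrow> x + y \<in> U_low a"
  and U_low_diff: "x \<in> U_low a \<Longrightarrow> y \<in> U_low a \<Longrightarrow> x - y \<in> U_low a"
  and U_low_scale: "x \<in> U_low a \<Longrightarrow> U_scale c x \<in> U_low a"
  and U_low_mono: "x \<in> U_low a \<Longrightarrow> b \<le> a \<Longrightarrow> x \<in> U_low b"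
  and U_low_U_r: "U_r i \<in> U_low 1"
  by (auto simp: U_low_def coords_add coords_diff coords_scale low_add low_diff low_scalar low_letter[simplified]
      elim: low_mono)

lemma U_low_coef: "x \<in> U_low a \<Longrightarrow> length w < a \<Longrightarrow> coef x w = 0"
  by (simp add: U_low_def coef_def low_lookup)

lemma U_low_mult_left: "y \<in> U_low a \<Longrightarrow> x * y \<in> U_low a"
  and U_low_mult_right: "y \<in> U_low a \<Longrightarrow> y * x \<in> U_low a"
  using U_low_mult[of x 0 y a] U_low_mult[of y a x 0] by simp_all

lemma U_ideal_subset_U_low: "U_ideal \<subseteq> (U_low 1 :: ('k::field, 'n) U set)"
proof -
  have "two_sided_ideal (U_low 1 :: ('k, 'n) U set)"
    by (auto simp: two_sided_ideal_def intro: U_low_add U_low_mult_left U_low_mult_right)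
  moreover have "range U_r \<subseteq> (U_low 1 :: ('k, 'n) U set)"
    using U_low_U_r by (rule image_subsetI)
  ultimately show ?thesis
    unfolding U_ideal_def ideal_generated_def by blast
qed

text \<open>Any shortest word with nonzero coefficient will do.\<close>

lemma leading_coef:
  assumes "x \<noteq> 0"
  obtains w where "x \<in> U_low (length w)" "coef x w \<noteq> 0"
proof -
  have "coords x \<noteq> 0"
    using assms coords_inj[of x 0] by auto
  then have "\<exists>w. coef x w \<noteq> 0"
    unfolding coef_def by (metis lookup_zero poly_mapping_eqI word.exhaust)
  then obtain w where w: "coef x w \<noteq> 0" "\<And>v. coef x v \<noteq> 0 \<Longrightarrow> length w \<le> length v"
    using ex_has_least_nat[of "\<lambda>w. coef x w \<noteq> 0" _ length] by blast
  have "coords x \<in> low (length w)"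
    by (rule lowI) (use w(2) in \<open>force simp: coef_def\<close>)
  with w(1) that show ?thesis by (simp add: U_low_def)
qed

section \<open>Absence of zero divisors\<close>

definition rename_vars :: "('a \<Rightarrow> 'b) \<Rightarrow> ('a multiset \<Rightarrow>\<^sub>0 'k::comm_ring_1) \<Rightarrow> ('b multiset \<Rightarrow>\<^sub>0 'k)" where
  "rename_vars f = extend (\<lambda>a c. Poly_Mapping.single (image_mset f a) c)"

lemma rename_vars_single: "rename_vars f (Poly_Mapping.single a c) = Poly_Mapping.single (image_mset f a) c"
  unfolding rename_vars_def by (rule extend_single) simp

lemma rename_vars_add: "rename_vars f (p + q) = rename_vars f p + rename_vars f q"
  unfolding rename_vars_def by (rule extend_add) (simp_all add: single_add)

lemma rename_vars_mult: "rename_vars f (p * q) = rename_vars f p * rename_vars f q"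
proof (induction p rule: free_algebra_induct)
  case (single a c)
  show ?case
    by (induction q rule: free_algebra_induct)
      (simp_all add: mult_single rename_vars_single distrib_left rename_vars_add)
qed (simp add: distrib_right rename_vars_add)

lemma lookup_rename_vars:
  assumes "inj f"
  shows "Poly_Mapping.lookup (rename_vars f p) (image_mset f a) = Poly_Mapping.lookup p a"
proof (induction p rule: free_algebra_induct)
  case (single b c)
  have "image_mset f b = image_mset f a \<longleftrightarrow> b = a"
    using multiset.inj_map[OF assms] by (auto dest: injD)
  then show ?case by (simp add: rename_vars_single lookup_single when_def)
qed (simp add: rename_vars_add lookup_add)

lemma rename_vars_eq_0:
  assumes "inj f" "rename_vars f p = 0"
  shows "p = 0"
  by (rule poly_mapping_eqI) (metis assms lookup_rename_vars lookup_zero)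

text \<open>The library proves that monoid algebras have no zero divisors only over ordered monoids of
  exponents, hence the renaming of the variables to natural numbers.\<close>

lemma lpoly_no_zero_divisors:
  fixes p q :: "('k::field, 'n::finite) lpoly"
  assumes "p * q = 0"
  shows "p = 0 \<or> q = 0"
proof -
  obtain f :: "'n \<Rightarrow> nat" where "inj f"
    using finite_imp_inj_to_nat_seg[of "UNIV :: 'n set"] by auto
  have "rename_vars f p * rename_vars f q = 0"
    using rename_vars_mult[of f p q] assms by (simp add: rename_vars_def)
  then show ?thesis
    using rename_vars_eq_0[OF \<open>inj f\<close>] by (metis mult_eq_0_iff)
qed

text \<open>Leading coefficients multiply by \<open>coef_mult\<close>, and polynomials have no zero
  divisors.\<close>

lemma U_no_zero_divisors:
  fixes x y :: "('k::field, 'n::finite) U"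
  assumes "x * y = 0"
  shows "x = 0 \<or> y = 0"
proof (rule ccontr)
  assume "\<not> ?thesis"
  then obtain w v where "x \<in> U_low (length w)" "coef x w \<noteq> 0" "y \<in> U_low (length v)" "coef y v \<noteq> 0"
    using leading_coef by metis
  then have "coef (x * y) (w @ v) \<noteq> 0"
    using lpoly_no_zero_divisors by (metis coef_mult)
  with assms show False by (simp add: coef_def)
qed

section \<open>Inner derivations\<close>

text \<open>The right action never touches the first letter: even l_j only shuffles behind it. So
  all words in an element of the right ideal r_i U_n begin with i.\<close>

lemma U_act_letter_mult: "\<exists>v'. U_act (letter i * v) x = letter i * v'"
proof (induction x arbitrary: v rule: U_induct)
  case one
  show ?case by auto
next
  case (l j)
  have "U_act (letter i * v) (U_l j) = letter i * (scalar (lvar j) * v + shuffle_letter j v)"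
    by (simp add: ad_l_letter_mult distrib_left mult_scalar_assoc)
  then show ?case by blast
next
  case (r j)
  show ?case by (auto simp: mult.assoc)
next
  case (scale c x)
  obtain v1 where "U_act (letter i * v) x = letter i * v1"
    using scale by blast
  then have "U_act (letter i * v) (U_scale c x) = letter i * (scalar (lconst c) * v1)"
    by (simp add: U_act_scale mult_scalar_assoc)
  then show ?case by blast
next
  case (add x y)
  obtain v1 v2 where "U_act (letter i * v) x = letter i * v1" "U_act (letter i * v) y = letter i * v2"
    using add by blast
  then have "U_act (letter i * v) (x + y) = letter i * (v1 + v2)"
    by (simp add: U_act_add distrib_left)
  then show ?case by blast
next
  case (mult x y)
  obtain v1 where "U_act (letter i * v) x = letter i * v1"
    using mult.IH(1) by blast
  then show ?case using mult.IH(2)[of v1] by (simp add: U_act_mult)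
qed

lemma coef_U_r_mult: "i \<noteq> k \<Longrightarrow> coef (U_r i * x) (k # w) = 0"
  using U_act_letter_mult[of i 1 x] lookup_letter_mult[of i _ k w]
  by (auto simp: coef_def coords_def U_act_mult)

definition inner :: "('k::field, 'n) U \<Rightarrow> ('k, 'n) U \<Rightarrow> ('k, 'n) U" where
  "inner u x = u * x - x * u"

text \<open>In the expansion of the iterated commutator every term but the last begins with
  \<open>u\<close>.\<close>

lemma inner_funpow:
  "\<exists>y. (inner u ^^ m) x = u * y + (- 1) ^ m * (x * u ^ m)"
proof (induction m)
  case 0
  show ?case by (rule exI[of _ 0]) simp
next
  case (Suc m)
  then obtain y where y: "(inner u ^^ m) x = u * y + (- 1) ^ m * (x * u ^ m)" by blast
  have comm: "u * (- 1) ^ m = (- 1) ^ m * u"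
    by (cases "even m") simp_all
  have "(inner u ^^ Suc m) x = u * ((inner u ^^ m) x - y * u) + (- 1) ^ Suc m * (x * u ^ Suc m)"
    unfolding funpow.simps comp_def inner_def[of u "(inner u ^^ m) x"]
    by (simp add: y algebra_simps flip: power_Suc2)
  then show ?case by blast
qed

lemma inner_not_nilpotent:
  fixes u :: "('k::field, 'n::finite) U"
  assumes "CARD('n) \<ge> 2" "u \<in> U_low 1" "u \<noteq> 0"
  shows "\<exists>i. \<forall>m. (inner u ^^ m) (U_r i) \<noteq> 0"
proof -
  obtain w where w: "u \<in> U_low (length w)" "coef u w \<noteq> 0"
    using leading_coef[OF assms(3)] by blast
  then obtain k v where kv: "w = k # v"
    using U_low_coef[OF assms(2), of "[]"] by (cases w) auto
  \<comment> \<open>A second letter is needed, different from the first letter of the leading word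
    of \<open>u\<close>.\<close>
  have "UNIV \<noteq> {k}"
  proof
    assume univ: "UNIV = {k}"
    have "CARD('n) = 1" unfolding univ by simp
    with assms(1) show False by simp
  qed
  then obtain i where i: "i \<noteq> k" by blast
  have "(inner u ^^ m) (U_r i) \<noteq> 0" for m
  proof
    assume zero: "(inner u ^^ m) (U_r i) = 0"
    obtain y where y: "(inner u ^^ m) (U_r i) = u * y + (- 1) ^ m * (U_r i * u ^ m)"
      using inner_funpow by blast
    define z where "z = - ((- 1) ^ m * u ^ m)"
    have z: "u * y = U_r i * z"
      using zero unfolding y z_def by (cases "even m") (simp_all add: eq_neg_iff_add_eq_0)
    have "u ^ m \<noteq> 0"
      using U_no_zero_divisors assms(3) by (induction m) (simp, force)
    then have "z \<noteq> 0"
      unfolding z_def by (cases "even m") simp_all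
    moreover have "U_r i \<noteq> (0 :: ('k, 'n) U)"
    proof
      assume "U_r i = (0 :: ('k, 'n) U)"
      moreover have "coef (U_r i :: ('k, 'n) U) [i] = 1" by (simp add: coef_U_r)
      ultimately show False by (simp add: coef_def)
    qed
    ultimately have "u * y \<noteq> 0"
      unfolding z using U_no_zero_divisors by blast
    then have "y \<noteq> 0" by auto
    then obtain v' where v': "y \<in> U_low (length v')" "coef y v' \<noteq> 0"
      using leading_coef by blast
    \<comment> \<open>This word begins with k: it leads in \<open>u * y\<close>, yet cannot occur in
      \<open>U_r i * z\<close>.\<close>
    have "coef (u * y) (w @ v') \<noteq> 0"
      using w v' lpoly_no_zero_divisors by (metis coef_mult)
    moreover have "coef (U_r i * z) (w @ v') = 0"
      unfolding kv using coef_U_r_mult[OF i] by simp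
    ultimately show False using z by simp
  qed
  then show ?thesis by blast
qed

section \<open>Derivations\<close>

lemma derivation_mult: "derivation D \<Longrightarrow> D (x * y) = D x * y + x * D y"
  and derivation_add: "derivation D \<Longrightarrow> D (x + y) = D x + D y"
  and derivation_scale: "derivation D \<Longrightarrow> D (U_scale c x) = U_scale c (D x)"
  by (simp_all add: derivation_def Vector_Spaces.linear_iff)

lemma derivation_one: "derivation D \<Longrightarrow> D 1 = 0"
  using derivation_mult[of D 1 1] by simp

lemma derivation_zero: "derivation D \<Longrightarrow> D 0 = 0"
  using derivation_add[of D 0 0] by simp

lemma derivation_eqI:
  assumes "derivation D" "derivation E" "\<And>i. D (U_l i) = E (U_l i)" "\<And>i. D (U_r i) = E (U_r i)"
  shows "D x = E x"
  by (induction x rule: U_induct)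
    (simp_all add: assms derivation_one derivation_mult derivation_add derivation_scale)

lemma derivation_U_low:
  assumes "derivation D" "\<And>i. D (U_l i) \<in> U_low a" "\<And>i. D (U_r i) \<in> U_low a"
  shows "D x \<in> U_low a"
  by (induction x rule: U_induct)
    (simp_all add: assms derivation_one[OF assms(1)] derivation_mult[OF assms(1)]
      derivation_add[OF assms(1)] derivation_scale[OF assms(1)] U_low_add U_low_scale
      U_low_mult_left U_low_mult_right)

lemma derivation_inner: "derivation (inner u)"
  unfolding derivation_def Vector_Spaces.linear_iff
  by (auto simp: inner_def algebra_simps U.scale_right_diff_distrib U.vector_space_axioms
    simp flip: U_scale_mult_left U_scale_mult_right)

lemma derivation_minus:
  assumes "derivation D" "derivation E"
  shows "derivation (\<lambda>x. D x - E x)"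
  using assms unfolding derivation_def Vector_Spaces.linear_iff
  by (auto simp: algebra_simps U.scale_right_diff_distrib)

text \<open>Modulo higher powers of the ideal, such a derivation acts on polynomials in \<open>r\<^sub>k\<close> as
  \<open>H r\<^sub>k\<^sup>2 \<partial>/\<partial>r\<^sub>k\<close>.\<close>

lemma derivation_raising_degree:
  fixes D :: "('k::field, 'n) U \<Rightarrow> ('k, 'n) U"
  assumes D: "derivation D" and low: "\<And>x. D x \<in> U_low 2"
    and coef_D: "\<And>i. coef (D (U_r i)) [k, k] = (if i = k then H else 0)"
    and "x \<in> U_low m"
  shows "D x \<in> U_low (Suc m) \<and>
    coef (D x) (replicate (Suc m) k) = of_nat m * H * coef x (replicate m k)"
  using assms(4)
proof (induction m arbitrary: x)
  case 0
  \<comment> \<open>\<open>D x\<close> starts at length 2, so its coefficient at the single letter k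
    is 0, matching the factor \<open>of_nat 0\<close>.\<close>
  show ?case
    using low[of x] U_low_coef[OF low, of "[k]" x] by (auto elim: U_low_mono)
next
  case (Suc m)
  let ?P = "\<lambda>x. D x \<in> U_low (Suc (Suc m)) \<and>
    coef (D x) (replicate (Suc (Suc m)) k) = of_nat (Suc m) * H * coef x (replicate (Suc m) k)"
  have "?P (assemble z)" if "z \<in> low (Suc m)" for z
    using that
  proof (induction rule: low_induct)
    case zero
    have "assemble 0 = (0 :: ('k, 'n) U)" by (simp add: assemble_def)
    then show ?case by (simp add: derivation_zero[OF D] coef_def)
  next
    case (add x y)
    then show ?case
      by (auto simp: assemble_add derivation_add[OF D] coef_add U_low_add distrib_left)
  next
    case (monomial w p)
    \<comment> \<open>Split off the last letter, because right multiplication by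
      \<open>U_r i\<close> is exact in coordinates; the product rule then combines the induction
      hypothesis for \<open>y\<close> with the assumption on \<open>D (U_r i)\<close>.\<close>
    then obtain w' i where w: "w = w' @ [i]" "m \<le> length w'"
      by (cases w rule: rev_cases) auto
    define y where "y = assemble (scalar p * monomial w')"
    have y: "y \<in> U_low m"
      using w(2) by (simp add: y_def U_low_def coords_assemble low_monomial)
    have split: "assemble (scalar p * monomial w) = y * U_r i"
      by (simp add: y_def w(1) monomial_append mult.assoc monomial_Cons monomial_Nil
        flip: assemble_mult_letter)
    note IH = Suc.IH[OF y]
    have Dx: "D (y * U_r i) = D y * U_r i + y * D (U_r i)"
      by (rule derivation_mult[OF D])
    \<comment> \<open>For i = k the two summands contribute m H and H times the coefficient of
      \<open>y\<close>; for i \<noteq> k both vanish.\<close>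
    have 1: "coef (D y * U_r i) (replicate (Suc m) k @ [k]) =
        coef (D y) (replicate (Suc m) k) * coef (U_r i) [k]"
      using IH U_low_U_r by (intro coef_mult) auto
    have 2: "coef (y * D (U_r i)) (replicate m k @ [k, k]) =
        coef y (replicate m k) * coef (D (U_r i)) [k, k]"
      using y low[of "U_r i"] by (intro coef_mult) (auto simp: numeral_2_eq_2)
    have 3: "coef (y * U_r i) (replicate m k @ [k]) = coef y (replicate m k) * coef (U_r i) [k]"
      using y U_low_U_r by (intro coef_mult) auto
    have rep: "replicate (Suc m) k @ [k] = replicate (Suc (Suc m)) k"
      "replicate m k @ [k, k] = replicate (Suc (Suc m)) k"
      "replicate m k @ [k] = replicate (Suc m) k"
      by (induction m) simp_all
    have "D (y * U_r i) \<in> U_low (Suc (Suc m))"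
      unfolding Dx using U_low_mult[OF conjunct1[OF IH] U_low_U_r] U_low_mult[OF y low]
      by (intro U_low_add) simp_all
    moreover have "coef (D (y * U_r i)) (replicate (Suc (Suc m)) k) =
        of_nat (Suc m) * H * coef (y * U_r i) (replicate (Suc m) k)"
      using 1 2 3 IH unfolding rep Dx coef_add
      by (simp add: coef_U_r coef_D algebra_simps del: replicate.simps)
    ultimately show ?case unfolding split by blast
  qed
  from this[of "coords x"] Suc.prems show ?case
    by (simp add: U_low_def assemble_coords)
qed

text \<open>Each application multiplies the coefficient of the pure power of r_k by the next
  positive integer and by \<open>H\<close>, which keeps it nonzero in characteristic 0.\<close>

lemma derivation_raising_degree_not_nilpotent:
  fixes D :: "('k::field_char_0, 'n::finite) U \<Rightarrow> ('k, 'n) U"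
  assumes "derivation D" "\<And>x. D x \<in> U_low 2"
    and "\<And>i. coef (D (U_r i)) [k, k] = (if i = k then H else 0)" and "H \<noteq> 0"
  shows "(D ^^ m) (U_r k) \<noteq> 0"
proof -
  have "(D ^^ m) (U_r k) \<in> U_low (Suc m) \<and> coef ((D ^^ m) (U_r k)) (replicate (Suc m) k) \<noteq> 0"
  proof (induction m)
    case 0
    show ?case using U_low_U_r by (simp add: coef_U_r)
  next
    case (Suc m)
    have "of_nat (Suc m) * H * coef ((D ^^ m) (U_r k)) (replicate (Suc m) k) \<noteq> 0"
      using Suc \<open>H \<noteq> 0\<close> lpoly_no_zero_divisors of_nat_neq_0 by metis
    then show ?case
      using derivation_raising_degree[OF assms(1-3), of "(D ^^ m) (U_r k)" "Suc m"] Suc by simp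
  qed
  then show ?thesis by (auto simp: coef_def)
qed

section \<open>Derivations with values in the ideal\<close>

lemma nat_invertible_lpoly: "nat_invertible TYPE(('k::field_char_0, 'n) lpoly)"
  unfolding nat_invertible_def
proof (intro allI impI)
  fix m :: nat assume "m > 0"
  then have "lconst (1 / of_nat m :: 'k) * of_nat m = (1 :: ('k, 'n) lpoly)"
    by (simp add: lconst_def mult_single flip: single_of_nat)
  then show "\<exists>c. c * of_nat m = (1 :: ('k, 'n) lpoly)" by blast
qed

lemma const_coeff_low: "x \<in> low 1 \<Longrightarrow> const_coeff x = 0"
  by (simp add: const_coeff_eq_scalar zero_word_def low_lookup)

lemma low_const_coeff: "const_coeff x = 0 \<Longrightarrow> x \<in> low 1"
proof (rule lowI)
  fix w :: "'a list" assume "const_coeff x = 0" "length w < 1"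
  then have "Poly_Mapping.lookup (scalar (Poly_Mapping.lookup x 0)) (0 :: 'a word) = 0"
    by (metis const_coeff_eq_scalar lookup_zero)
  with \<open>length w < 1\<close> show "Poly_Mapping.lookup x (Word w) = 0"
    by (simp add: scalar_def zero_word_def)
qed

text \<open>The hypotheses make \<open>h\<close> a combination of single letters.\<close>

lemma component_linear_form:
  fixes h :: "('n::finite, 'l::comm_ring_1) free"
  assumes "const_coeff h = 0" "\<And>k. strip k h = const_coeff (strip k h)" "m \<noteq> 1"
  shows "component m h = 0"
proof -
  have "component m (letter k * scalar c) = 0" for k :: 'n and c :: 'l
  proof (cases m)
    case (Suc b)
    have "component b (1 :: ('n, 'l) free) = 0"
      unfolding monomial_Nil[symmetric] component_monomial using Suc \<open>m \<noteq> 1\<close> by simp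
    then have "component b (scalar c :: ('n, 'l) free) = 0"
      using scalar_linear_scalar[OF scalar_linear_component, of b c "1 :: ('n, 'l) free"] by simp
    then show ?thesis using Suc by (simp add: component_letter_mult)
  qed (simp add: component_0_letter_mult)
  then have zero: "component m (letter k * strip k h) = 0" for k
    by (metis assms(2) const_coeff_eq_scalar)
  show ?thesis
    by (subst free_decompose)
      (simp add: assms(1) zero scalar_linear_sum[OF scalar_linear_component])
qed

text \<open>Applying \<open>D\<close> to l_i l_j = l_j l_i gives exactly the cocycle condition of
  \<open>ad_l_cocycle_trivial\<close>.\<close>

lemma derivation_eq_inner_on_l:
  fixes D :: "('k::field_char_0, 'n::finite) U \<Rightarrow> ('k, 'n) U"
  assumes "CARD('n) \<ge> 2" and D: "derivation D" and low: "\<And>x. D x \<in> U_low 1"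
  obtains u where "u \<in> U_low 1" "\<And>i. D (U_l i) = inner u (U_l i)"
proof -
  let ?f = "\<lambda>i. coords (D (U_l i))"
  have "const_coeff (?f i) = 0" for i
    using low by (simp add: U_low_def const_coeff_low)
  moreover have "ad_l j (?f i) = ad_l i (?f j)" for i j
  proof -
    have "D (U_l i) * U_l j + U_l i * D (U_l j) = D (U_l j) * U_l i + U_l j * D (U_l i)"
      using arg_cong[OF U_l_commute, of D i j] by (simp only: derivation_mult[OF D])
    from arg_cong[OF this, of coords] show ?thesis
      by (simp add: coords_add coords_mult_U_l coords_U_l_mult)
  qed
  ultimately obtain v where v: "const_coeff v = 0" "\<And>i. ?f i = ad_l i v"
    using ad_l_cocycle_trivial[OF nat_invertible_lpoly assms(1), of ?f] by blast
  define u where "u = assemble v"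
  have "D (U_l i) = inner u (U_l i)" for i
    by (rule coords_inj)
      (simp add: v(2) inner_def u_def coords_diff coords_mult_U_l coords_U_l_mult coords_assemble)
  moreover have "u \<in> U_low 1"
    using low_const_coeff[OF v(1)] by (simp add: u_def U_low_def coords_assemble)
  ultimately show ?thesis using that by blast
qed

text \<open>Applying \<open>E\<close> to r_i l_j = l_j r_i + r_i r_j shows that the lowest parts of
  the E(r_i) define a derivation commuting with every \<open>ad_l j\<close>. They are therefore r_i
  h with h linear, which is possible in degree 2 only, unless they vanish.\<close>

lemma derivation_vanishing_on_l:
  fixes E :: "('k::field_char_0, 'n::finite) U \<Rightarrow> ('k, 'n) U"
  assumes E: "derivation E" and l: "\<And>i. E (U_l i) = 0" and low: "\<And>i. E (U_r i) \<in> U_low 1"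
  obtains "\<And>x. E x = 0"
  | k H where "\<And>i. E (U_r i) \<in> U_low 2" "H \<noteq> 0"
    "\<And>i. coef (E (U_r i)) [k, k] = (if i = k then H else 0)"
proof -
  let ?g = "\<lambda>i. coords (E (U_r i))"
  \<comment> \<open>The last product stays in \<open>U\<close>, since left multiplication by r_i is
    letter multiplication only modulo longer words.\<close>
  have rel: "ad_l j (?g i) = ?g i * letter j + coords (U_r i * E (U_r j))" for i j
  proof -
    have "E (U_r i) * U_l j = U_l j * E (U_r i) + (E (U_r i) * U_r j + U_r i * E (U_r j))"
      using arg_cong[OF U_r_U_l, of E i j]
      by (simp add: derivation_mult[OF E] derivation_add[OF E] l)
    from arg_cong[OF this, of coords] show ?thesis
      by (simp add: coords_add coords_mult_U_l coords_U_l_mult coords_mult_U_r)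
  qed
  have lowest: "\<exists>h. (\<forall>i. component m (?g i) = letter i * h) \<and> const_coeff h = 0 \<and>
      (\<forall>k. strip k h = const_coeff (strip k h))"
    if "m \<ge> 1" and gm: "\<And>i. E (U_r i) \<in> U_low m" for m
  proof -
    have "const_coeff (component m (?g i)) = 0" for i
      using that(1) by (simp add: const_coeff_eq_scalar zero_word_def lookup_component)
    moreover have "ad_l j (component m (?g i)) =
        component m (?g i) * letter j + letter i * component m (?g j)" for i j
    proof -
      have "component (Suc m) (coords (U_r i * E (U_r j)) - letter i * ?g j) = 0"
        using coords_mult_low[OF U_low_U_r gm, of i j] by (intro component_low) simp
      then have "component (Suc m) (coords (U_r i * E (U_r j))) = letter i * component m (?g j)"
        by (simp add: scalar_linear_diff[OF scalar_linear_component] component_letter_mult)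
      with arg_cong[OF rel[of j i], of "component (Suc m)"] show ?thesis
        by (simp add: component_ad_l component_mult_letter linear_simps)
    qed
    ultimately show ?thesis
      using ad_l_commuting_derivation[OF nat_invertible_lpoly, of "\<lambda>i. component m (?g i)"] by metis
  qed
  have step: "E (U_r i) \<in> U_low (Suc m)"
    if m: "m \<ge> 1" "m \<noteq> 2" and gm: "\<And>i. E (U_r i) \<in> U_low m" for m i
  proof -
    obtain h where h: "\<forall>i. component m (?g i) = letter i * h" "const_coeff h = 0"
      "\<forall>k. strip k h = const_coeff (strip k h)"
      using lowest[OF m(1) gm] by blast
    obtain b where b: "m = Suc b" using m(1) by (cases m) auto
    \<comment> \<open>\<open>h\<close> has degree 1, so this product lives in degree 2, and m
      \<noteq> 2.\<close>
    have "component m (letter i * h) = 0"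
      using component_linear_form[of h b] h m b by (simp add: component_letter_mult)
    moreover have "component m (component m (?g i)) = component m (?g i)"
      by (rule poly_mapping_eqI) (metis lookup_component word.exhaust)
    ultimately have "component m (?g i) = 0"
      using h(1) by metis
    then show ?thesis
      using gm[of i] low_Suc[of "?g i" m] by (simp add: U_low_def)
  qed
  have low2: "E (U_r i) \<in> U_low 2" for i
    using step[of 1 i] low by (simp add: numeral_2_eq_2)
  obtain h where h: "\<And>i. component 2 (?g i) = letter i * h" "const_coeff h = 0"
    "\<And>k. strip k h = const_coeff (strip k h)"
    using lowest[of 2] low2 by auto
  show ?thesis
  proof (cases "h = 0")
    case True
    \<comment> \<open>\<open>step\<close> does not cover degree 2; there \<open>h = 0\<close>
      carries the bound across. Beyond it \<open>step\<close> climbs forever, which forces E(r_i) =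
      0.\<close>
    have "E (U_r i) \<in> U_low (m + 3)" for m i
    proof (induction m arbitrary: i)
      case 0
      then show ?case using low_Suc[of "?g i" 2] low2[of i] h(1)[of i] True by (simp add: U_low_def)
    next
      case (Suc m)
      then show ?case using step[of "m + 3" i] by simp
    qed
    then have "E (U_r i) = 0" for i
      using U_low_coef[of "E (U_r i)"] leading_coef by (metis less_add_same_cancel1 zero_less_numeral)
    then have "E x = 0" for x
      using derivation_eqI[OF E derivation_inner[of 0], of x] l by (simp add: inner_def)
    then show ?thesis by (rule that(1))
  next
    case False
    then obtain k where k: "strip k h \<noteq> 0"
      using strip_eqI[of h 0] h(2) by (auto simp: scalar_linear_zero)
    \<comment> \<open>The coefficient of r_k in the linear form \<open>h\<close>, a polynomial in
      the l_i.\<close>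
    define H where "H = Poly_Mapping.lookup (strip k h) 0"
    have "strip k h = scalar H"
      unfolding H_def using h(3) const_coeff_eq_scalar by metis
    with k have "H \<noteq> 0" by auto
    have "Poly_Mapping.lookup (strip k x) (Word w) = Poly_Mapping.lookup x (Word (k # w))"
      for x :: "('n, ('k, 'n) lpoly) free" and w
    proof -
      have "Poly_Mapping.lookup x (Word (k # w)) = Poly_Mapping.lookup
          (const_coeff x + (\<Sum>i\<in>UNIV. letter i * strip i x)) (Word (k # w))"
        by (simp flip: free_decompose)
      also have "\<dots> = Poly_Mapping.lookup (strip k x) (Word w)"
        by (simp add: lookup_add lookup_sum lookup_letter_mult const_coeff_eq_scalar scalar_def
          lookup_single zero_word_def)
      finally show ?thesis by simp
    qed
    then have "Poly_Mapping.lookup h (Word [k]) = H"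
      unfolding H_def zero_word_def by simp
    then have "coef (E (U_r i)) [k, k] = (if i = k then H else 0)" for i
      using arg_cong[OF h(1)[of i], of "\<lambda>x. Poly_Mapping.lookup x (Word [k, k])"]
      by (simp add: lookup_component lookup_letter_mult coef_def)
    with that(2) low2 \<open>H \<noteq> 0\<close> show ?thesis by blast
  qed
qed

theorem theorem2:
  fixes D :: "('k::field_char_0, 'n::finite) U \<Rightarrow> ('k, 'n) U"
  assumes "CARD('n) \<ge> 2"
    and "derivation D"
    and "locally_nilpotent D"
    and "range D \<subseteq> U_ideal"
  shows "D = (\<lambda>_. 0)"
proof -
  have low: "D x \<in> U_low 1" for x
    using assms(4) U_ideal_subset_U_low by blast
  obtain u where u: "u \<in> U_low 1" and D_l: "\<And>i. D (U_l i) = inner u (U_l i)"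
    using derivation_eq_inner_on_l[OF assms(1,2) low] by blast
  define E where "E x = D x - inner u x" for x
  have E: "derivation E"
    unfolding E_def using assms(2) derivation_inner by (rule derivation_minus)
  have inner_low: "inner u (U_r i) \<in> U_low 2" for i
    unfolding inner_def using U_low_mult[OF u U_low_U_r, of i] U_low_mult[OF U_low_U_r u, of i]
    by (intro U_low_diff) (simp_all add: numeral_2_eq_2)
  have "E (U_r i) \<in> U_low 1" for i
    unfolding E_def using low U_low_mono[OF inner_low[of i], of 1] by (intro U_low_diff) simp_all
  moreover have "E (U_l i) = 0" for i
    by (simp add: E_def D_l)
  ultimately consider "\<And>x. E x = 0"
    | k H where "\<And>i. E (U_r i) \<in> U_low 2" "H \<noteq> 0"
      "\<And>i. coef (E (U_r i)) [k, k] = (if i = k then H else 0)"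
    using derivation_vanishing_on_l[OF E] by metis
  then show ?thesis
  proof cases
    case 1
    then have D_inner: "D = inner u"
      by (auto simp: E_def fun_eq_iff)
    have "u = 0"
    proof (rule ccontr)
      assume "u \<noteq> 0"
      then obtain i where "\<And>m. (inner u ^^ m) (U_r i) \<noteq> 0"
        using inner_not_nilpotent[OF assms(1) u] by blast
      with assms(3) show False
        by (auto simp: locally_nilpotent_def D_inner)
    qed
    then show ?thesis
      by (simp add: D_inner inner_def fun_eq_iff)
  next
    case (2 k H)
    \<comment> \<open>Local nilpotence is known for \<open>D\<close>, not for \<open>E\<close>, so
      the inner part must be shown to respect the degree bound and to leave the coefficients at r_k
      r_k unchanged.\<close>
    have D_r: "D (U_r i) = E (U_r i) + inner u (U_r i)" for i
      by (simp add: E_def)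
    have "D (U_l i) \<in> U_low 2" for i
    proof -
      have "coords (D (U_l i)) = ad_l i (coords u)"
        by (simp add: D_l inner_def coords_diff coords_mult_U_l coords_U_l_mult)
      then show ?thesis using u low_ad_l[of "coords u" 1 i] by (simp add: U_low_def numeral_2_eq_2)
    qed
    moreover have "D (U_r i) \<in> U_low 2" for i
      unfolding D_r using 2(1) inner_low by (rule U_low_add)
    ultimately have low2: "D x \<in> U_low 2" for x
      by (rule derivation_U_low[OF assms(2)])
    \<comment> \<open>Both products have the same coefficient at this word, as polynomials in the
      l_i commute.\<close>
    have "coef (inner u (U_r i)) [k, k] = 0" for i
    proof -
      have "coef (u * U_r i) ([k] @ [k]) = coef u [k] * coef (U_r i) [k]"
        "coef (U_r i * u) ([k] @ [k]) = coef (U_r i) [k] * coef u [k]"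
        by (intro coef_mult; simp add: u[simplified] U_low_U_r[simplified])+
      then show ?thesis by (simp add: inner_def coef_diff mult.commute)
    qed
    then have "coef (D (U_r i)) [k, k] = (if i = k then H else 0)" for i
      unfolding D_r coef_add 2(3) by simp
    then have "(D ^^ m) (U_r k) \<noteq> 0" for m
      using derivation_raising_degree_not_nilpotent[OF assms(2) low2 _ 2(2)] by blast
    with assms(3) show ?thesis
      by (auto simp: locally_nilpotent_def)
  qed
qed

end
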